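(* Let $\mathbb{R}=(R,r)$ be an epireflector on a category $\mathbf{C}$. Let $MonE(\mathbf{C})$ be the category (with morphisms of monads) of those monads over $\mathbf{C}$ that preserve epimorphisms and whose composition with $R$ gives a monad. Let $RMonE(\mathbf{C})$ be the (full) subcategory of $MonE(\mathbf{C})$ consisting of those monads whose ranges are in $R(\mathbf{C})$. Then the embedding $I:RMonE(\mathbf{C})\to MonE(\mathbf{C})$ admits a left adjoint.
   Context: A reflective subcategory of $\mathbf{C}$ is a full subcategory whose inclusion into $\mathbf{C}$ has a left adjoint $R$; with unit $r:1\to R$, the pair $\mathbb{R}=(R,r)$ is called a reflector, the reflective subcategory is denoted $R(\mathbf{C})$, and $R$ is regarded as an endofunctor of $\mathbf{C}$ (an idempotent monad with unit $r$ and multiplication $(r_R)^{-1}:RR\to R$). $(R,r)$ is an epireflector if each $r_X$ is an epimorphism in $\mathbf{C}$. For a monad $\mathbb{T}=(T,\mu,\eta)$, $\mathbf{C}^{\mathbb{T}}$ is its category of (Eilenberg-Moore) algebras and $G^{\mathbb{T}}:\mathbf{C}^{\mathbb{T}}\to\mathbf{C}$ the forgetful functor. A monad $\mathbb{T}$ preserves epimorphisms if its functor $T$ does; its range is in $R(\mathbf{C})$ if $TX\in R(\mathbf{C})$ for all $X$. A morphism of monads $(T,\mu,\eta)\to(M,n,e)$ is a natural transformation $\alpha:T\to M$ with $\alpha\cdot\eta=e$ and $\alpha\cdot\mu=n\cdot(\alpha\circ\alpha)$, where $\alpha\circ\alpha=\alpha M\cdot T\alpha$. "The composition of $\mathbb{T}$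 with $R$ gives a monad" means that $R$ lifts to $\mathbf{C}^{\mathbb{T}}$, i.e. there is a monad $\tilde{\mathbb{R}}=(\tilde{R},\tilde{n},d)$ on $\mathbf{C}^{\mathbb{T}}$ with $G^{\mathbb{T}}\tilde{R}=RG^{\mathbb{T}}$, whose unit $d$ and multiplication $\tilde{n}$ have as underlying natural transformations the unit $rG^{\mathbb{T}}$ and multiplication of $R$; then one has the composite monad $\mathbb{R}\circ\mathbb{T}=(RT,w,r\circ\eta)$, where $(r\circ\eta)_X=r_{TX}\cdot\eta_X$ and, writing $\tilde{R}(TX,\mu_X)=(RTX,\tilde{\mu}_X)$ with $\tilde{\mu}_X:TRTX\to RTX$, $w_X$ is the unique morphism with $w_X\cdot r_{TRTX}=\tilde{\mu}_X$. *)

theory Defs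
  imports Main "HOL-Library.FuncSet"
begin

section \<open>Categories\<close>

record ('o, 'm) category =
  Obj :: "'o set"
  Arr :: "'m set"
  Dom :: "'m \<Rightarrow> 'o"
  Cod :: "'m \<Rightarrow> 'o"
  Ide :: "'o \<Rightarrow> 'm"
  Comp :: "'m \<Rightarrow> 'm \<Rightarrow> 'm"  (infixr "\<cdot>\<index>" 70)

definition hom :: "('o, 'm) category \<Rightarrow> 'o \<Rightarrow> 'o \<Rightarrow> 'm set" where
  "hom C X Y = {f \<in> Arr C. Dom C f = X \<and> Cod C f = Y}"

locale category =
  fixes C :: "('o, 'm) category" (structure)
  assumes Dom_in_Obj: "f \<in> Arr C \<Longrightarrow> Dom C f \<in> Obj C"
    and Cod_in_Obj: "f \<in> Arr C \<Longrightarrow> Cod C f \<in> Obj C"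
    and Ide_in_hom: "X \<in> Obj C \<Longrightarrow> Ide C X \<in> hom C X X"
    and Comp_in_hom: "f \<in> hom C X Y \<Longrightarrow> g \<in> hom C Y Z \<Longrightarrow> g \<cdot> f \<in> hom C X Z"
    and Comp_Ide: "f \<in> hom C X Y \<Longrightarrow> f \<cdot> Ide C X = f"
    and Ide_Comp: "f \<in> hom C X Y \<Longrightarrow> Ide C Y \<cdot> f = f"
    and Comp_assoc: "f \<in> hom C W X \<Longrightarrow> g \<in> hom C X Y \<Longrightarrow> h \<in> hom C Y Z \<Longrightarrow>
      (h \<cdot> g) \<cdot> f = h \<cdot> (g \<cdot> f)"

definition epi :: "('o, 'm) category \<Rightarrow> 'm \<Rightarrow> bool" where
  "epi C f \<longleftrightarrow> f \<in> Arr C \<and>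
    (\<forall>Z. \<forall>g \<in> hom C (Cod C f) Z. \<forall>h \<in> hom C (Cod C f) Z.
      g \<cdot>\<^bsub>C\<^esub> f = h \<cdot>\<^bsub>C\<^esub> f \<longrightarrow> g = h)"

definition inverse_arrows :: "('o, 'm) category \<Rightarrow> 'm \<Rightarrow> 'm \<Rightarrow> bool" where
  "inverse_arrows C f g \<longleftrightarrow> f \<in> Arr C \<and> g \<in> hom C (Cod C f) (Dom C f) \<and>
    g \<cdot>\<^bsub>C\<^esub> f = Ide C (Dom C f) \<and> f \<cdot>\<^bsub>C\<^esub> g = Ide C (Cod C f)"

definition inv_arr :: "('o, 'm) category \<Rightarrow> 'm \<Rightarrow> 'm" where
  "inv_arr C f = (THE g. inverse_arrows C f g)"

definition full_subcategory :: "('o, 'm) category \<Rightarrow> 'o set \<Rightarrow> ('o, 'm) category" where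
  "full_subcategory C S = C\<lparr>Obj := Obj C \<inter> S,
     Arr := {f \<in> Arr C. Dom C f \<in> S \<and> Cod C f \<in> S}\<rparr>"


section \<open>Functors, natural transformations, adjunctions\<close>

text \<open>
  Functors and natural transformations are required to be extensional (undefined outside the
  objects and arrows of their domain), so that equality in HOL is mathematical equality.
  A functor does not record its domain and codomain.  In particular a functor into a full
  subcategory is literally also a functor into the ambient category.
\<close>

record ('o, 'm, 'p, 'n) cat_functor =
  on_obj :: "'o \<Rightarrow> 'p"
  on_arr :: "'m \<Rightarrow> 'n"

locale is_functor = C: category C + D: category D
  for C :: "('o, 'm) category" and D :: "('p, 'n) category"
    and F :: "('o, 'm, 'p, 'n) cat_functor" +
  assumes on_obj_PiE: "on_obj F \<in> Obj C \<rightarrow>\<^sub>E Obj D"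
    and on_arr_extensional: "on_arr F \<in> extensional (Arr C)"
    and on_arr_in_hom: "f \<in> hom C X Y \<Longrightarrow> on_arr F f \<in> hom D (on_obj F X) (on_obj F Y)"
    and on_arr_Ide: "X \<in> Obj C \<Longrightarrow> on_arr F (Ide C X) = Ide D (on_obj F X)"
    and on_arr_Comp: "f \<in> hom C X Y \<Longrightarrow> g \<in> hom C Y Z \<Longrightarrow>
      on_arr F (g \<cdot>\<^bsub>C\<^esub> f) = on_arr F g \<cdot>\<^bsub>D\<^esub> on_arr F f"

text \<open>
  The first argument is the domain; applied to a subcategory this is its inclusion functor.
\<close>
definition inclusion_functor :: "('o, 'm) category \<Rightarrow> ('o, 'm, 'o, 'm) cat_functor" where
  "inclusion_functor C = \<lparr>on_obj = (\<lambda>X\<in>Obj C. X), on_arr = (\<lambda>f\<in>Arr C. f)\<rparr>"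

abbreviation (input) identity_functor :: "('o, 'm) category \<Rightarrow> ('o, 'm, 'o, 'm) cat_functor" where
  "identity_functor \<equiv> inclusion_functor"

definition functor_comp ::
  "('o, 'm) category \<Rightarrow> ('p, 'n, 'q, 'k) cat_functor \<Rightarrow> ('o, 'm, 'p, 'n) cat_functor \<Rightarrow>
   ('o, 'm, 'q, 'k) cat_functor" where
  "functor_comp C G F = \<lparr>on_obj = compose (Obj C) (on_obj G) (on_obj F),
     on_arr = compose (Arr C) (on_arr G) (on_arr F)\<rparr>"

locale nat_trans = F: is_functor C D F + G: is_functor C D G
  for C :: "('o, 'm) category" and D :: "('p, 'n) category"
    and F :: "('o, 'm, 'p, 'n) cat_functor" and G :: "('o, 'm, 'p, 'n) cat_functor"
    and \<tau> :: "'o \<Rightarrow> 'n" +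
  assumes component_extensional: "\<tau> \<in> extensional (Obj C)"
    and component_in_hom: "X \<in> Obj C \<Longrightarrow> \<tau> X \<in> hom D (on_obj F X) (on_obj G X)"
    and naturality: "f \<in> hom C X Y \<Longrightarrow>
      on_arr G f \<cdot>\<^bsub>D\<^esub> \<tau> X = \<tau> Y \<cdot>\<^bsub>D\<^esub> on_arr F f"

locale adjunction =
  L: is_functor C D L + G: is_functor D C G +
  unit: nat_trans C C "identity_functor C" "functor_comp C G L" \<eta> +
  counit: nat_trans D D "functor_comp D L G" "identity_functor D" \<epsilon>
  for C :: "('o, 'm) category" and D :: "('p, 'n) category"
    and L :: "('o, 'm, 'p, 'n) cat_functor" and G :: "('p, 'n, 'o, 'm) cat_functor"
    and \<eta> :: "'o \<Rightarrow> 'm" and \<epsilon> :: "'p \<Rightarrow> 'n" +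
  assumes triangle_L: "X \<in> Obj C \<Longrightarrow>
      \<epsilon> (on_obj L X) \<cdot>\<^bsub>D\<^esub> on_arr L (\<eta> X) = Ide D (on_obj L X)"
    and triangle_G: "Y \<in> Obj D \<Longrightarrow>
      on_arr G (\<epsilon> Y) \<cdot>\<^bsub>C\<^esub> \<eta> (on_obj G Y) = Ide C (on_obj G Y)"

definition has_left_adjoint ::
  "('p, 'n) category \<Rightarrow> ('o, 'm) category \<Rightarrow> ('p, 'n, 'o, 'm) cat_functor \<Rightarrow> bool" where
  "has_left_adjoint D C G \<longleftrightarrow> (\<exists>L \<eta> \<epsilon>. adjunction C D L G \<eta> \<epsilon>)"


section \<open>Epireflectors\<close>

text \<open>
  The set \<open>A\<close> consists of the objects of the reflective subcategory.  It is not assumed to be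
  closed under isomorphism.
\<close>

definition reflector ::
  "('o, 'm) category \<Rightarrow> 'o set \<Rightarrow> ('o, 'm, 'o, 'm) cat_functor \<Rightarrow> ('o \<Rightarrow> 'm) \<Rightarrow> bool" where
  "reflector C A R r \<longleftrightarrow> A \<subseteq> Obj C \<and>
    (\<exists>\<epsilon>. adjunction C (full_subcategory C A) R (inclusion_functor (full_subcategory C A)) r \<epsilon>)"

definition epireflector ::
  "('o, 'm) category \<Rightarrow> 'o set \<Rightarrow> ('o, 'm, 'o, 'm) cat_functor \<Rightarrow> ('o \<Rightarrow> 'm) \<Rightarrow> bool" where
  "epireflector C A R r \<longleftrightarrow> reflector C A R r \<and> (\<forall>X\<in>Obj C. epi C (r X))"


section \<open>Monads and their algebras\<close>

record ('o, 'm) monad =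
  Fun :: "('o, 'm, 'o, 'm) cat_functor"
  Mult :: "'o \<Rightarrow> 'm"
  Unit :: "'o \<Rightarrow> 'm"

locale is_monad =
  F: is_functor C C "Fun T" +
  mult: nat_trans C C "functor_comp C (Fun T) (Fun T)" "Fun T" "Mult T" +
  unit: nat_trans C C "identity_functor C" "Fun T" "Unit T"
  for C :: "('o, 'm) category" and T :: "('o, 'm) monad" +
  assumes Mult_assoc: "X \<in> Obj C \<Longrightarrow>
      Mult T X \<cdot>\<^bsub>C\<^esub> Mult T (on_obj (Fun T) X) = Mult T X \<cdot>\<^bsub>C\<^esub> on_arr (Fun T) (Mult T X)"
    and Mult_Unit: "X \<in> Obj C \<Longrightarrow>
      Mult T X \<cdot>\<^bsub>C\<^esub> Unit T (on_obj (Fun T) X) = Ide C (on_obj (Fun T) X)"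
    and Mult_Fun_Unit: "X \<in> Obj C \<Longrightarrow>
      Mult T X \<cdot>\<^bsub>C\<^esub> on_arr (Fun T) (Unit T X) = Ide C (on_obj (Fun T) X)"

definition reflector_monad ::
  "('o, 'm) category \<Rightarrow> ('o, 'm, 'o, 'm) cat_functor \<Rightarrow> ('o \<Rightarrow> 'm) \<Rightarrow> ('o, 'm) monad" where
  "reflector_monad C R r =
    \<lparr>Fun = R, Mult = (\<lambda>X\<in>Obj C. inv_arr C (r (on_obj R X))), Unit = r\<rparr>"

definition algebra :: "('o, 'm) category \<Rightarrow> ('o, 'm) monad \<Rightarrow> 'o \<times> 'm \<Rightarrow> bool" where
  "algebra C T = (\<lambda>(X, \<xi>). X \<in> Obj C \<and> \<xi> \<in> hom C (on_obj (Fun T) X) X \<and>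
    \<xi> \<cdot>\<^bsub>C\<^esub> Unit T X = Ide C X \<and>
    \<xi> \<cdot>\<^bsub>C\<^esub> Mult T X = \<xi> \<cdot>\<^bsub>C\<^esub> on_arr (Fun T) \<xi>)"

definition algebra_hom ::
  "('o, 'm) category \<Rightarrow> ('o, 'm) monad \<Rightarrow> 'o \<times> 'm \<Rightarrow> 'm \<Rightarrow> 'o \<times> 'm \<Rightarrow> bool" where
  "algebra_hom C T = (\<lambda>(X, \<xi>) f (Y, \<theta>). f \<in> hom C X Y \<and>
    f \<cdot>\<^bsub>C\<^esub> \<xi> = \<theta> \<cdot>\<^bsub>C\<^esub> on_arr (Fun T) f)"

text \<open>Arrows carry their domain and codomain.\<close>
definition EM_category ::
  "('o, 'm) category \<Rightarrow> ('o, 'm) monad \<Rightarrow>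
   ('o \<times> 'm, ('o \<times> 'm) \<times> 'm \<times> ('o \<times> 'm)) category" where
  "EM_category C T = \<lparr>
     Obj = {a. algebra C T a},
     Arr = {(a, f, b). algebra C T a \<and> algebra C T b \<and> algebra_hom C T a f b},
     Dom = (\<lambda>(a, f, b). a),
     Cod = (\<lambda>(a, f, b). b),
     Ide = (\<lambda>a. (a, Ide C (fst a), a)),
     Comp = (\<lambda>(b', g, c) (a, f, b). (a, g \<cdot>\<^bsub>C\<^esub> f, c))\<rparr>"

definition EM_forgetful ::
  "('o, 'm) category \<Rightarrow> ('o, 'm) monad \<Rightarrow>
   ('o \<times> 'm, ('o \<times> 'm) \<times> 'm \<times> ('o \<times> 'm), 'o, 'm) cat_functor" where
  "EM_forgetful C T = \<lparr>
     on_obj = (\<lambda>(X, \<xi>)\<in>Obj (EM_category C T). X),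
     on_arr = (\<lambda>(a, f, b)\<in>Arr (EM_category C T). f)\<rparr>"

definition lifts_to_algebras ::
  "('o, 'm) category \<Rightarrow> ('o, 'm) monad \<Rightarrow> ('o, 'm) monad \<Rightarrow> bool" where
  "lifts_to_algebras C M T \<longleftrightarrow>
    (\<exists>M'. is_monad (EM_category C T) M' \<and>
      functor_comp (EM_category C T) (EM_forgetful C T) (Fun M') =
        functor_comp (EM_category C T) (Fun M) (EM_forgetful C T) \<and>
      (\<forall>a \<in> Obj (EM_category C T).
        on_arr (EM_forgetful C T) (Unit M' a) = Unit M (on_obj (EM_forgetful C T) a) \<and>
        on_arr (EM_forgetful C T) (Mult M' a) = Mult M (on_obj (EM_forgetful C T) a)))"


section \<open>Categories of monads\<close>

locale monad_morphism =
  S: is_monad C S + T: is_monad C T + nat_trans C C "Fun S" "Fun T" \<alpha>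
  for C :: "('o, 'm) category" and S :: "('o, 'm) monad" and T :: "('o, 'm) monad"
    and \<alpha> :: "'o \<Rightarrow> 'm" +
  assumes preserves_Unit: "X \<in> Obj C \<Longrightarrow> \<alpha> X \<cdot>\<^bsub>C\<^esub> Unit S X = Unit T X"
    and preserves_Mult: "X \<in> Obj C \<Longrightarrow>
      \<alpha> X \<cdot>\<^bsub>C\<^esub> Mult S X =
        Mult T X \<cdot>\<^bsub>C\<^esub> (\<alpha> (on_obj (Fun T) X) \<cdot>\<^bsub>C\<^esub> on_arr (Fun S) (\<alpha> X))"

definition monad_category ::
  "('o, 'm) category \<Rightarrow>
   (('o, 'm) monad, ('o, 'm) monad \<times> ('o \<Rightarrow> 'm) \<times> ('o, 'm) monad) category" where
  "monad_category C = \<lparr>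
     Obj = {T. is_monad C T},
     Arr = {(S, \<alpha>, T). monad_morphism C S T \<alpha>},
     Dom = (\<lambda>(S, \<alpha>, T). S),
     Cod = (\<lambda>(S, \<alpha>, T). T),
     Ide = (\<lambda>T. (T, (\<lambda>X\<in>Obj C. Ide C (on_obj (Fun T) X)), T)),
     Comp = (\<lambda>(T', \<beta>, U) (S, \<alpha>, T). (S, (\<lambda>X\<in>Obj C. \<beta> X \<cdot>\<^bsub>C\<^esub> \<alpha> X), U))\<rparr>"

definition preserves_epis :: "('o, 'm) category \<Rightarrow> ('o, 'm, 'o, 'm) cat_functor \<Rightarrow> bool" where
  "preserves_epis C F \<longleftrightarrow> (\<forall>f. epi C f \<longrightarrow> epi C (on_arr F f))"

definition MonE ::
  "('o, 'm) category \<Rightarrow> ('o, 'm, 'o, 'm) cat_functor \<Rightarrow> ('o \<Rightarrow> 'm) \<Rightarrow>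
   (('o, 'm) monad, ('o, 'm) monad \<times> ('o \<Rightarrow> 'm) \<times> ('o, 'm) monad) category" where
  "MonE C R r = full_subcategory (monad_category C)
     {T. preserves_epis C (Fun T) \<and> lifts_to_algebras C (reflector_monad C R r) T}"

definition RMonE ::
  "('o, 'm) category \<Rightarrow> 'o set \<Rightarrow> ('o, 'm, 'o, 'm) cat_functor \<Rightarrow> ('o \<Rightarrow> 'm) \<Rightarrow>
   (('o, 'm) monad, ('o, 'm) monad \<times> ('o \<Rightarrow> 'm) \<times> ('o, 'm) monad) category" where
  "RMonE C A R r = full_subcategory (MonE C R r) {T. \<forall>X\<in>Obj C. on_obj (Fun T) X \<in> A}"

end

theory Submission
  imports Defs
begin

text \<open>
  The left adjoint sends a monad \<open>T\<close> to the composite monad \<open>RT\<close>, and the unit of the adjunction at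
  \<open>T\<close> is \<open>r\<^bsub>T\<^esub> : T \<rightarrow> RT\<close>. So it suffices to show that \<open>RT\<close> lies in the subcategory and that
  \<open>r\<^bsub>T\<^esub>\<close> is a universal arrow (\<open>has_left_adjoint_if_universal_arrows\<close>).

  Nearly every equation is checked by cancelling one of two kinds of epimorphism: a component of \<open>r\<close>,
  which is epi because \<open>R\<close> is an epireflector, or its image under \<open>T\<close>, which is epi because \<open>T\<close>
  preserves epimorphisms. The lifting of \<open>R\<close> to algebras enters through the free algebras \<open>TX\<close>:
  \<open>RTX\<close> carries a \<open>T\<close>-algebra structure \<open>TRTX \<rightarrow> RTX\<close> that makes \<open>r\<^bsub>TX\<^esub>\<close> a homomorphism, and
  the factorization of this structure through \<open>r\<^bsub>TRTX\<^esub>\<close> is the multiplication of \<open>RT\<close>. Cancellation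
  then yields the monad laws (\<open>is_monad_RT\<close>). \<open>RT\<close> preserves epimorphisms because \<open>R\<close> does
  (\<open>R_preserves_epi\<close>).

  For \<open>RT\<close> to be an object of the subcategory, \<open>R\<close> must also lift to \<open>RT\<close>-algebras. This
  holds for every monad \<open>S\<close> with range in \<open>R(C)\<close> (\<open>lifts_to_algebras_of_range\<close>): the carrier \<open>X\<close> of an
  \<open>S\<close>-algebra is a retract of \<open>SX\<close>, hence \<open>r\<^bsub>X\<^esub>\<close> is an isomorphism, and the algebra structure can be
  transported along it to \<open>RX\<close>.

  Finally, if \<open>M\<close> has range in \<open>R(C)\<close>, each component \<open>TX \<rightarrow> MX\<close> of a monad morphism factors uniquely
  through \<open>r\<^bsub>TX\<^esub>\<close>, and the factorizations form a monad morphism, once more by cancellation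
  (\<open>ex1_factor_through_rT\<close>).
\<close>


section \<open>Calculating with arrows\<close>

context category
begin

lemma Dom_Obj [simp]: "f \<in> Arr C \<Longrightarrow> Dom C f \<in> Obj C"
  and Cod_Obj [simp]: "f \<in> Arr C \<Longrightarrow> Cod C f \<in> Obj C"
  by (simp_all add: Dom_in_Obj Cod_in_Obj)

lemma Ide_simps [simp]:
  assumes "X \<in> Obj C"
  shows "Ide C X \<in> Arr C" "Dom C (Ide C X) = X" "Cod C (Ide C X) = X"
  using Ide_in_hom[OF assms] by (auto simp: hom_def)

lemma Comp_simps [simp]:
  assumes "f \<in> Arr C" "g \<in> Arr C" "Cod C f = Dom C g"
  shows "g \<cdot> f \<in> Arr C" "Dom C (g \<cdot> f) = Dom C f" "Cod C (g \<cdot> f) = Cod C g"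
  using Comp_in_hom[of f "Dom C f" "Dom C g" g "Cod C g"] assms by (auto simp: hom_def)

lemma Comp_Ide_simps [simp]:
  assumes "f \<in> Arr C"
  shows "Dom C f = X \<Longrightarrow> f \<cdot> Ide C X = f" "Cod C f = Y \<Longrightarrow> Ide C Y \<cdot> f = f"
  using Comp_Ide Ide_Comp assms by (auto simp: hom_def)

lemma assoc [simp]:
  assumes "f \<in> Arr C" "g \<in> Arr C" "h \<in> Arr C" "Cod C f = Dom C g" "Cod C g = Dom C h"
  shows "(h \<cdot> g) \<cdot> f = h \<cdot> (g \<cdot> f)"
  using Comp_assoc assms by (auto simp: hom_def)

text \<open>
  As composites are normalized to the right, an equation \<open>g \<cdot> f = k\<close> does not match inside
  \<open>g \<cdot> (f \<cdot> e)\<close>; this form does.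
\<close>
lemma extend_eq:
  assumes "g \<cdot> f = k" "f \<in> Arr C" "g \<in> Arr C" "Cod C f = Dom C g"
    and "e \<in> Arr C" "Cod C e = Dom C f"
  shows "g \<cdot> (f \<cdot> e) = k \<cdot> e"
  using assms assoc by metis

lemma epi_cancel:
  assumes "epi C f" "g \<cdot> f = h \<cdot> f"
    and "g \<in> Arr C" "h \<in> Arr C" "Dom C g = Cod C f" "Dom C h = Cod C f" "Cod C g = Cod C h"
  shows "g = h"
  using assms unfolding epi_def hom_def by auto

lemma epi_Comp:
  assumes "epi C f" "epi C g" "Cod C f = Dom C g"
  shows "epi C (g \<cdot> f)"
proof -
  have fg: "f \<in> Arr C" "g \<in> Arr C"
    using assms unfolding epi_def by auto
  have "h = k" if "h \<in> hom C (Cod C g) Z" "k \<in> hom C (Cod C g) Z"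
    and eq: "h \<cdot> (g \<cdot> f) = k \<cdot> (g \<cdot> f)" for h k Z
  proof (rule epi_cancel[OF assms(2)])
    show "h \<cdot> g = k \<cdot> g"
      by (rule epi_cancel[OF assms(1)]) (use that fg assms(3) in \<open>auto simp: hom_def\<close>)
  qed (use that in \<open>auto simp: hom_def\<close>)
  then show ?thesis
    using fg assms(3) unfolding epi_def by auto
qed

lemma epi_of_Comp:
  assumes "epi C (g \<cdot> f)" "f \<in> Arr C" "g \<in> Arr C" "Cod C f = Dom C g"
  shows "epi C g"
  unfolding epi_def
proof (intro conjI allI ballI impI)
  fix Z h k
  assume h: "h \<in> hom C (Cod C g) Z" "k \<in> hom C (Cod C g) Z" "h \<cdot> g = k \<cdot> g"
  have "h \<cdot> (g \<cdot> f) = (h \<cdot> g) \<cdot> f" "k \<cdot> (g \<cdot> f) = (k \<cdot> g) \<cdot> f"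
    using h(1,2) assms(2-4) by (auto simp: hom_def)
  then have "h \<cdot> (g \<cdot> f) = k \<cdot> (g \<cdot> f)"
    by (simp only: h(3))
  then show "h = k"
    by (rule epi_cancel[OF assms(1)]) (use h(1,2) assms(2-4) in \<open>auto simp: hom_def\<close>)
qed (fact assms(3))

lemma inv_arr_eq:
  assumes "inverse_arrows C f g"
  shows "inv_arr C f = g"
  unfolding inv_arr_def
proof (rule the_equality, rule assms)
  fix h
  assume h: "inverse_arrows C f h"
  have "h = h \<cdot> (f \<cdot> g)"
    using h assms by (auto simp: inverse_arrows_def hom_def)
  also have "\<dots> = (h \<cdot> f) \<cdot> g"
    by (rule assoc[symmetric]) (use h assms in \<open>auto simp: inverse_arrows_def hom_def\<close>)
  also have "\<dots> = g"
    using h assms by (auto simp: inverse_arrows_def hom_def)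
  finally show "h = g" .
qed

end

context is_functor
begin

lemma functor_simps [simp]:
  shows "X \<in> Obj C \<Longrightarrow> on_obj F X \<in> Obj D"
    and "f \<in> Arr C \<Longrightarrow> on_arr F f \<in> Arr D"
    and "f \<in> Arr C \<Longrightarrow> Dom D (on_arr F f) = on_obj F (Dom C f)"
    and "f \<in> Arr C \<Longrightarrow> Cod D (on_arr F f) = on_obj F (Cod C f)"
    and "X \<in> Obj C \<Longrightarrow> on_arr F (Ide C X) = Ide D (on_obj F X)"
  using on_obj_PiE on_arr_in_hom[of f "Dom C f" "Cod C f"] on_arr_Ide by (auto simp: hom_def)

lemma functor_Comp:
  assumes "f \<in> Arr C" "g \<in> Arr C" "Cod C f = Dom C g"
  shows "on_arr F (g \<cdot>\<^bsub>C\<^esub> f) = on_arr F g \<cdot>\<^bsub>D\<^esub> on_arr F f"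
  using on_arr_Comp[of f "Dom C f" "Dom C g" g "Cod C g"] assms by (auto simp: hom_def)

end

context nat_trans
begin

lemma component_simps [simp]:
  assumes "X \<in> Obj C"
  shows "\<tau> X \<in> Arr D" "Dom D (\<tau> X) = on_obj F X" "Cod D (\<tau> X) = on_obj G X"
  using component_in_hom[OF assms] by (auto simp: hom_def)

lemma naturality_Arr:
  assumes "f \<in> Arr C"
  shows "on_arr G f \<cdot>\<^bsub>D\<^esub> \<tau> (Dom C f) = \<tau> (Cod C f) \<cdot>\<^bsub>D\<^esub> on_arr F f"
  using naturality[of f "Dom C f" "Cod C f"] assms by (auto simp: hom_def)

end

lemma functor_comp_simps [simp]:
  shows "X \<in> Obj C \<Longrightarrow> on_obj (functor_comp C G F) X = on_obj G (on_obj F X)"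
    and "f \<in> Arr C \<Longrightarrow> on_arr (functor_comp C G F) f = on_arr G (on_arr F f)"
  by (auto simp: functor_comp_def compose_def)

lemma inclusion_functor_simps [simp]:
  shows "X \<in> Obj C \<Longrightarrow> on_obj (inclusion_functor C) X = X"
    and "f \<in> Arr C \<Longrightarrow> on_arr (inclusion_functor C) f = f"
  by (auto simp: inclusion_functor_def)

lemma is_functorI:
  assumes "category C" "category D"
    and "\<And>X. X \<in> Obj C \<Longrightarrow> on_obj F X \<in> Obj D"
    and "on_obj F \<in> extensional (Obj C)" "on_arr F \<in> extensional (Arr C)"
    and "\<And>f. f \<in> Arr C \<Longrightarrow> on_arr F f \<in> Arr D \<and> Dom D (on_arr F f) = on_obj F (Dom C f) \<and>
      Cod D (on_arr F f) = on_obj F (Cod C f)"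
    and "\<And>X. X \<in> Obj C \<Longrightarrow> on_arr F (Ide C X) = Ide D (on_obj F X)"
    and "\<And>f g. f \<in> Arr C \<Longrightarrow> g \<in> Arr C \<Longrightarrow> Cod C f = Dom C g \<Longrightarrow>
      on_arr F (g \<cdot>\<^bsub>C\<^esub> f) = on_arr F g \<cdot>\<^bsub>D\<^esub> on_arr F f"
  shows "is_functor C D F"
proof -
  interpret C: category C by fact
  interpret D: category D by fact
  show ?thesis
    by unfold_locales (use assms in \<open>auto simp: hom_def PiE_def\<close>)
qed

lemma is_functor_comp:
  assumes "is_functor C D F" "is_functor D E G"
  shows "is_functor C E (functor_comp C G F)"
proof -
  interpret F: is_functor C D F by fact
  interpret G: is_functor D E G by fact
  show ?thesis
    by (rule is_functorI)
      (auto simp: F.C.category_axioms G.D.category_axioms F.functor_Comp G.functor_Comp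
        functor_comp_def compose_def)
qed

lemma is_functor_identity:
  assumes "category C"
  shows "is_functor C C (identity_functor C)"
proof -
  interpret category C by fact
  show ?thesis
    by (rule is_functorI) (use assms in \<open>auto simp: inclusion_functor_def\<close>)
qed

lemma nat_transI:
  assumes "is_functor C D F" "is_functor C D G" "\<tau> \<in> extensional (Obj C)"
    and "\<And>X. X \<in> Obj C \<Longrightarrow>
      \<tau> X \<in> Arr D \<and> Dom D (\<tau> X) = on_obj F X \<and> Cod D (\<tau> X) = on_obj G X"
    and "\<And>f. f \<in> Arr C \<Longrightarrow>
      on_arr G f \<cdot>\<^bsub>D\<^esub> \<tau> (Dom C f) = \<tau> (Cod C f) \<cdot>\<^bsub>D\<^esub> on_arr F f"
  shows "nat_trans C D F G \<tau>"
proof -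
  interpret F: is_functor C D F by fact
  interpret G: is_functor C D G by fact
  show ?thesis
    by unfold_locales (use assms in \<open>auto simp: hom_def\<close>)
qed


section \<open>Left adjoints from universal arrows\<close>

text \<open>
  The functor \<open>L\<close> on arrows and the counit are the factorizations of \<open>u Y \<cdot> f\<close> and of the identity of
  \<open>G Y\<close> through the universal arrows; all laws follow from uniqueness of factorizations.
\<close>
lemma has_left_adjoint_if_universal_arrows:
  assumes "is_functor D C G"
    and univ: "\<And>X. X \<in> Obj C \<Longrightarrow> \<exists>Y\<in>Obj D. \<exists>u\<in>hom C X (on_obj G Y).
      \<forall>Z\<in>Obj D. \<forall>f\<in>hom C X (on_obj G Z). \<exists>!g. g \<in> hom D Y Z \<and> on_arr G g \<cdot>\<^bsub>C\<^esub> u = f"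
  shows "has_left_adjoint D C G"
proof -
  interpret G: is_functor D C G by fact
  obtain l u where l: "\<And>X. X \<in> Obj C \<Longrightarrow> l X \<in> Obj D"
    and u: "\<And>X. X \<in> Obj C \<Longrightarrow> u X \<in> hom C X (on_obj G (l X))"
    and ex1: "\<And>X Z f. X \<in> Obj C \<Longrightarrow> Z \<in> Obj D \<Longrightarrow> f \<in> hom C X (on_obj G Z) \<Longrightarrow>
        \<exists>!g. g \<in> hom D (l X) Z \<and> on_arr G g \<cdot>\<^bsub>C\<^esub> u X = f"
    using univ by metis
  define fac where "fac X Z f = (THE g. g \<in> hom D (l X) Z \<and> on_arr G g \<cdot>\<^bsub>C\<^esub> u X = f)" for X Z f
  have fac: "fac X Z f \<in> Arr D \<and> Dom D (fac X Z f) = l X \<and> Cod D (fac X Z f) = Z \<and>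
      on_arr G (fac X Z f) \<cdot>\<^bsub>C\<^esub> u X = f"
    if "X \<in> Obj C" "Z \<in> Obj D" "f \<in> Arr C" "Dom C f = X" "Cod C f = on_obj G Z" for X Z f
    using theI'[OF ex1, of X Z f] that unfolding fac_def hom_def by auto
  have u_simps: "u X \<in> Arr C" "Dom C (u X) = X" "Cod C (u X) = on_obj G (l X)"
    if "X \<in> Obj C" for X
    using u[OF that] by (auto simp: hom_def)
  have uniq: "g = h"
    if "X \<in> Obj C" "g \<in> Arr D" "h \<in> Arr D" "Dom D g = l X" "Dom D h = l X" "Cod D g = Cod D h"
      "on_arr G g \<cdot>\<^bsub>C\<^esub> u X = on_arr G h \<cdot>\<^bsub>C\<^esub> u X" for X g h
    using ex1[of X "Cod D g" "on_arr G g \<cdot>\<^bsub>C\<^esub> u X"] that u_simps by (auto simp: hom_def)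
  define L where "L = \<lparr>on_obj = (\<lambda>X\<in>Obj C. l X),
    on_arr = (\<lambda>f\<in>Arr C. fac (Dom C f) (l (Cod C f)) (u (Cod C f) \<cdot>\<^bsub>C\<^esub> f))\<rparr>"
  have L_obj: "on_obj L X = l X" if "X \<in> Obj C" for X
    using that by (simp add: L_def)
  have L_arr: "on_arr L f \<in> Arr D" "Dom D (on_arr L f) = l (Dom C f)"
      "Cod D (on_arr L f) = l (Cod C f)"
      "on_arr G (on_arr L f) \<cdot>\<^bsub>C\<^esub> u (Dom C f) = u (Cod C f) \<cdot>\<^bsub>C\<^esub> f"
    if "f \<in> Arr C" for f
    using that fac[of "Dom C f" "l (Cod C f)" "u (Cod C f) \<cdot>\<^bsub>C\<^esub> f"] l u_simps
    by (auto simp: L_def)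
  have L: "is_functor C D L"
  proof (rule is_functorI)
    fix X assume X: "X \<in> Obj C"
    show "on_arr L (Ide C X) = Ide D (on_obj L X)"
      by (rule uniq[of X]) (use X L_arr[of "Ide C X"] u_simps l in \<open>auto simp: L_obj\<close>)
  next
    fix f g assume fg: "f \<in> Arr C" "g \<in> Arr C" "Cod C f = Dom C g"
    show "on_arr L (g \<cdot>\<^bsub>C\<^esub> f) = on_arr L g \<cdot>\<^bsub>D\<^esub> on_arr L f"
      by (rule uniq[of "Dom C f"])
        (use fg L_arr[of f] L_arr[of g] L_arr[of "g \<cdot>\<^bsub>C\<^esub> f"] u_simps
          G.D.extend_eq[OF L_arr(4)[of g]] in \<open>auto simp: G.functor_Comp\<close>)
  qed (use L_arr l in \<open>auto simp: L_obj L_def G.C.category_axioms G.D.category_axioms\<close>)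
  define \<epsilon> where "\<epsilon> = (\<lambda>Y\<in>Obj D. fac (on_obj G Y) Y (Ide C (on_obj G Y)))"
  have \<epsilon>: "\<epsilon> Y \<in> Arr D" "Dom D (\<epsilon> Y) = l (on_obj G Y)" "Cod D (\<epsilon> Y) = Y"
      "on_arr G (\<epsilon> Y) \<cdot>\<^bsub>C\<^esub> u (on_obj G Y) = Ide C (on_obj G Y)" if "Y \<in> Obj D" for Y
    using fac[of "on_obj G Y" Y "Ide C (on_obj G Y)"] that by (auto simp: \<epsilon>_def)
  have "nat_trans C C (identity_functor C) (functor_comp C G L) (\<lambda>X\<in>Obj C. u X)"
    by (rule nat_transI)
      (use is_functor_identity[OF G.D.category_axioms] is_functor_comp[OF L assms(1)] u_simps L_arr
        in \<open>auto simp: L_obj\<close>)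
  moreover have "nat_trans D D (functor_comp D L G) (identity_functor D) \<epsilon>"
  proof (rule nat_transI)
    fix f assume f: "f \<in> Arr D"
    have "on_arr G f \<cdot>\<^bsub>C\<^esub> on_arr G (\<epsilon> (Dom D f)) \<cdot>\<^bsub>C\<^esub> u (on_obj G (Dom D f)) =
        on_arr G (\<epsilon> (Cod D f)) \<cdot>\<^bsub>C\<^esub> on_arr G (on_arr L (on_arr G f)) \<cdot>\<^bsub>C\<^esub> u (on_obj G (Dom D f))"
      using f \<epsilon> u_simps L_arr[of "on_arr G f"] G.D.extend_eq[OF \<epsilon>(4)[of "Cod D f"]] by auto
    then have "f \<cdot>\<^bsub>D\<^esub> \<epsilon> (Dom D f) = \<epsilon> (Cod D f) \<cdot>\<^bsub>D\<^esub> on_arr L (on_arr G f)"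
      by (intro uniq[of "on_obj G (Dom D f)"])
        (use f \<epsilon> u_simps L_arr[of "on_arr G f"] in \<open>auto simp: G.functor_Comp\<close>)
    then show "on_arr (identity_functor D) f \<cdot>\<^bsub>D\<^esub> \<epsilon> (Dom D f) =
        \<epsilon> (Cod D f) \<cdot>\<^bsub>D\<^esub> on_arr (functor_comp D L G) f"
      using f by simp
  qed (use is_functor_identity[OF G.C.category_axioms] is_functor_comp[OF assms(1) L] \<epsilon>
      in \<open>auto simp: L_obj, auto simp: \<epsilon>_def\<close>)
  moreover have "\<epsilon> (on_obj L X) \<cdot>\<^bsub>D\<^esub> on_arr L (restrict u (Obj C) X) = Ide D (on_obj L X)"
    if X: "X \<in> Obj C" for X
    by (rule uniq[of X])
      (use X l u_simps L_arr[of "u X"] \<epsilon>[of "l X"] G.D.extend_eq[OF \<epsilon>(4)[of "l X"]]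
        in \<open>auto simp: L_obj G.functor_Comp\<close>)
  ultimately have "adjunction C D L G (\<lambda>X\<in>Obj C. u X) \<epsilon>"
    using L assms(1) \<epsilon> by (auto simp: adjunction_def adjunction_axioms_def)
  then show ?thesis
    unfolding has_left_adjoint_def by blast
qed


section \<open>Full subcategories and the category of monads\<close>

lemma full_subcategory_simps [simp]:
  "Obj (full_subcategory C S) = Obj C \<inter> S"
  "Arr (full_subcategory C S) = {f \<in> Arr C. Dom C f \<in> S \<and> Cod C f \<in> S}"
  "Dom (full_subcategory C S) = Dom C"
  "Cod (full_subcategory C S) = Cod C"
  "Ide (full_subcategory C S) = Ide C"
  "Comp (full_subcategory C S) = Comp C"
  by (simp_all add: full_subcategory_def)

lemma category_full_subcategory:
  assumes "category C"
  shows "category (full_subcategory C S)"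
proof -
  interpret category C by fact
  show ?thesis
    by unfold_locales (auto simp: hom_def)
qed

lemma is_functor_full_inclusion:
  assumes "category C"
  shows "is_functor (full_subcategory C S) C (inclusion_functor (full_subcategory C S))"
proof -
  interpret category C by fact
  interpret S: category "full_subcategory C S"
    by (rule category_full_subcategory[OF assms])
  show ?thesis
    by (rule is_functorI) (auto simp: category_axioms S.category_axioms inclusion_functor_def)
qed

lemma is_monadI:
  assumes "is_functor C C (Fun T)"
    and "Mult T \<in> extensional (Obj C)" "Unit T \<in> extensional (Obj C)"
    and "\<And>X. X \<in> Obj C \<Longrightarrow> Mult T X \<in> Arr C \<and>
      Dom C (Mult T X) = on_obj (Fun T) (on_obj (Fun T) X) \<and> Cod C (Mult T X) = on_obj (Fun T) X"
    and "\<And>X. X \<in> Obj C \<Longrightarrow>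
      Unit T X \<in> Arr C \<and> Dom C (Unit T X) = X \<and> Cod C (Unit T X) = on_obj (Fun T) X"
    and "\<And>f. f \<in> Arr C \<Longrightarrow> on_arr (Fun T) f \<cdot>\<^bsub>C\<^esub> Mult T (Dom C f) =
      Mult T (Cod C f) \<cdot>\<^bsub>C\<^esub> on_arr (Fun T) (on_arr (Fun T) f)"
    and "\<And>f. f \<in> Arr C \<Longrightarrow>
      on_arr (Fun T) f \<cdot>\<^bsub>C\<^esub> Unit T (Dom C f) = Unit T (Cod C f) \<cdot>\<^bsub>C\<^esub> f"
    and "\<And>X. X \<in> Obj C \<Longrightarrow>
      Mult T X \<cdot>\<^bsub>C\<^esub> Mult T (on_obj (Fun T) X) = Mult T X \<cdot>\<^bsub>C\<^esub> on_arr (Fun T) (Mult T X)"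
    and "\<And>X. X \<in> Obj C \<Longrightarrow>
      Mult T X \<cdot>\<^bsub>C\<^esub> Unit T (on_obj (Fun T) X) = Ide C (on_obj (Fun T) X)"
    and "\<And>X. X \<in> Obj C \<Longrightarrow>
      Mult T X \<cdot>\<^bsub>C\<^esub> on_arr (Fun T) (Unit T X) = Ide C (on_obj (Fun T) X)"
  shows "is_monad C T"
proof -
  interpret T: is_functor C C "Fun T" by fact
  have "nat_trans C C (functor_comp C (Fun T) (Fun T)) (Fun T) (Mult T)"
    by (rule nat_transI) (use assms is_functor_comp in auto)
  moreover have "nat_trans C C (identity_functor C) (Fun T) (Unit T)"
    by (rule nat_transI) (use assms is_functor_identity T.C.category_axioms in auto)
  ultimately show ?thesis
    using assms by (simp add: is_monad_def is_monad_axioms_def)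
qed

context is_monad
begin

lemma monad_simps [simp]:
  assumes "X \<in> Obj C"
  shows "Mult T X \<in> Arr C" "Dom C (Mult T X) = on_obj (Fun T) (on_obj (Fun T) X)"
    "Cod C (Mult T X) = on_obj (Fun T) X"
    "Unit T X \<in> Arr C" "Dom C (Unit T X) = X" "Cod C (Unit T X) = on_obj (Fun T) X"
  using assms mult.component_simps[OF assms] unit.component_simps[OF assms] by auto

lemma Mult_natural:
  assumes "f \<in> Arr C"
  shows "on_arr (Fun T) f \<cdot>\<^bsub>C\<^esub> Mult T (Dom C f) =
    Mult T (Cod C f) \<cdot>\<^bsub>C\<^esub> on_arr (Fun T) (on_arr (Fun T) f)"
  using mult.naturality_Arr[OF assms] assms by simp

lemma Unit_natural:
  assumes "f \<in> Arr C"
  shows "on_arr (Fun T) f \<cdot>\<^bsub>C\<^esub> Unit T (Dom C f) = Unit T (Cod C f) \<cdot>\<^bsub>C\<^esub> f"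
  using unit.naturality_Arr[OF assms] assms by simp

end

lemma monad_category_simps [simp]:
  "Obj (monad_category C) = {T. is_monad C T}"
  "Arr (monad_category C) = {(S, \<alpha>, T). monad_morphism C S T \<alpha>}"
  "Dom (monad_category C) (S, \<alpha>, T) = S"
  "Cod (monad_category C) (S, \<alpha>, T) = T"
  "Ide (monad_category C) T = (T, (\<lambda>X\<in>Obj C. Ide C (on_obj (Fun T) X)), T)"
  "(T', \<beta>, U) \<cdot>\<^bsub>monad_category C\<^esub> (S, \<alpha>, T) = (S, (\<lambda>X\<in>Obj C. \<beta> X \<cdot>\<^bsub>C\<^esub> \<alpha> X), U)"
  by (simp_all add: monad_category_def)

lemma monad_morphism_Ide:
  assumes "is_monad C T"
  shows "monad_morphism C T T (\<lambda>X\<in>Obj C. Ide C (on_obj (Fun T) X))"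
proof -
  interpret is_monad C T by fact
  have "nat_trans C C (Fun T) (Fun T) (\<lambda>X\<in>Obj C. Ide C (on_obj (Fun T) X))"
    by (rule nat_transI) (auto simp: F.is_functor_axioms)
  then show ?thesis
    using assms by (simp add: monad_morphism_def monad_morphism_axioms_def)
qed

lemma monad_morphism_Comp:
  assumes "monad_morphism C S T \<alpha>" "monad_morphism C T U \<beta>"
  shows "monad_morphism C S U (\<lambda>X\<in>Obj C. \<beta> X \<cdot>\<^bsub>C\<^esub> \<alpha> X)"
proof -
  interpret a: monad_morphism C S T \<alpha> by fact
  interpret b: monad_morphism C T U \<beta> by fact
  note eq = a.S.F.C.extend_eq
  have "nat_trans C C (Fun S) (Fun U) (\<lambda>X\<in>Obj C. \<beta> X \<cdot>\<^bsub>C\<^esub> \<alpha> X)"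
  proof (rule nat_transI)
    fix f assume f: "f \<in> Arr C"
    show "on_arr (Fun U) f \<cdot>\<^bsub>C\<^esub> (\<lambda>X\<in>Obj C. \<beta> X \<cdot>\<^bsub>C\<^esub> \<alpha> X) (Dom C f) =
        (\<lambda>X\<in>Obj C. \<beta> X \<cdot>\<^bsub>C\<^esub> \<alpha> X) (Cod C f) \<cdot>\<^bsub>C\<^esub> on_arr (Fun S) f"
      using f eq[OF b.naturality_Arr[OF f], of "\<alpha> (Dom C f)"] a.naturality_Arr[OF f] by simp
  qed (auto simp: a.S.F.is_functor_axioms b.T.F.is_functor_axioms)
  moreover have "(\<beta> X \<cdot>\<^bsub>C\<^esub> \<alpha> X) \<cdot>\<^bsub>C\<^esub> Unit S X = Unit U X" if "X \<in> Obj C" for X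
    using that a.preserves_Unit[OF that] b.preserves_Unit[OF that] by simp
  moreover have "(\<beta> X \<cdot>\<^bsub>C\<^esub> \<alpha> X) \<cdot>\<^bsub>C\<^esub> Mult S X = Mult U X \<cdot>\<^bsub>C\<^esub>
      ((\<beta> (on_obj (Fun U) X) \<cdot>\<^bsub>C\<^esub> \<alpha> (on_obj (Fun U) X)) \<cdot>\<^bsub>C\<^esub> on_arr (Fun S) (\<beta> X \<cdot>\<^bsub>C\<^esub> \<alpha> X))"
    if X: "X \<in> Obj C" for X
    using X a.preserves_Mult[OF X] eq[OF b.preserves_Mult[OF X]]
      eq[OF a.naturality_Arr[of "\<beta> X"]] by (simp add: a.S.F.functor_Comp)
  ultimately show ?thesis
    by (simp add: monad_morphism_def monad_morphism_axioms_def
        a.S.is_monad_axioms b.T.is_monad_axioms)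
qed

lemma category_monad_category:
  assumes "category C"
  shows "category (monad_category C)"
proof -
  interpret category C by fact
  have dom_cod: "is_monad C S" "is_monad C T" "\<alpha> \<in> extensional (Obj C)"
    "X \<in> Obj C \<Longrightarrow> \<alpha> X \<in> Arr C" "X \<in> Obj C \<Longrightarrow> Dom C (\<alpha> X) = on_obj (Fun S) X"
    "X \<in> Obj C \<Longrightarrow> Cod C (\<alpha> X) = on_obj (Fun T) X"
    if "monad_morphism C S T \<alpha>" for S T \<alpha> X
  proof -
    interpret monad_morphism C S T \<alpha> by fact
    show "is_monad C S" "is_monad C T" "\<alpha> \<in> extensional (Obj C)"
      "X \<in> Obj C \<Longrightarrow> \<alpha> X \<in> Arr C" "X \<in> Obj C \<Longrightarrow> Dom C (\<alpha> X) = on_obj (Fun S) X"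
      "X \<in> Obj C \<Longrightarrow> Cod C (\<alpha> X) = on_obj (Fun T) X"
      by (auto simp: S.is_monad_axioms T.is_monad_axioms component_extensional)
  qed
  show ?thesis
    by unfold_locales
      (auto simp: hom_def dom_cod monad_morphism_Ide intro: monad_morphism_Comp
        intro!: extensionalityI[where A = "Obj C"])
qed


section \<open>Lifting a monad to algebras\<close>

lemma algebra_iff:
  "algebra C T a \<longleftrightarrow> fst a \<in> Obj C \<and> snd a \<in> Arr C \<and> Dom C (snd a) = on_obj (Fun T) (fst a) \<and>
    Cod C (snd a) = fst a \<and> snd a \<cdot>\<^bsub>C\<^esub> Unit T (fst a) = Ide C (fst a) \<and>
    snd a \<cdot>\<^bsub>C\<^esub> Mult T (fst a) = snd a \<cdot>\<^bsub>C\<^esub> on_arr (Fun T) (snd a)"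
  by (cases a) (auto simp: algebra_def hom_def)

lemma algebra_hom_iff:
  "algebra_hom C T a f b \<longleftrightarrow> f \<in> Arr C \<and> Dom C f = fst a \<and> Cod C f = fst b \<and>
    f \<cdot>\<^bsub>C\<^esub> snd a = snd b \<cdot>\<^bsub>C\<^esub> on_arr (Fun T) f"
  by (cases a; cases b) (auto simp: algebra_hom_def hom_def)

lemma EM_category_simps [simp]:
  "Obj (EM_category C T) = {a. algebra C T a}"
  "Arr (EM_category C T) = {(a, f, b). algebra C T a \<and> algebra C T b \<and> algebra_hom C T a f b}"
  "Dom (EM_category C T) (a, f, b) = a"
  "Cod (EM_category C T) (a, f, b) = b"
  "Ide (EM_category C T) a = (a, Ide C (fst a), a)"
  "(b', g, c) \<cdot>\<^bsub>EM_category C T\<^esub> (a, f, b) = (a, g \<cdot>\<^bsub>C\<^esub> f, c)"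
  by (simp_all add: EM_category_def)

lemma EM_forgetful_simps [simp]:
  shows "algebra C T a \<Longrightarrow> on_obj (EM_forgetful C T) a = fst a"
    and "algebra C T a \<Longrightarrow> algebra C T b \<Longrightarrow> algebra_hom C T a f b \<Longrightarrow>
      on_arr (EM_forgetful C T) (a, f, b) = f"
  by (simp_all add: EM_forgetful_def split_beta)

lemma category_EM_category:
  assumes "is_monad C T"
  shows "category (EM_category C T)"
proof -
  interpret is_monad C T by fact
  have Comp: "algebra_hom C T a (g \<cdot>\<^bsub>C\<^esub> f) c"
    if "algebra_hom C T a f b" "algebra_hom C T b g c"
      "algebra C T a" "algebra C T b" "algebra C T c" for a b c f g
  proof -
    note hyps = that[unfolded algebra_iff algebra_hom_iff]
    have "g \<cdot>\<^bsub>C\<^esub> (f \<cdot>\<^bsub>C\<^esub> snd a) = g \<cdot>\<^bsub>C\<^esub> (snd b \<cdot>\<^bsub>C\<^esub> on_arr (Fun T) f)"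
      using hyps by metis
    also have "\<dots> = (snd c \<cdot>\<^bsub>C\<^esub> on_arr (Fun T) g) \<cdot>\<^bsub>C\<^esub> on_arr (Fun T) f"
      by (rule F.C.extend_eq) (use hyps in simp_all)
    also have "\<dots> = snd c \<cdot>\<^bsub>C\<^esub> on_arr (Fun T) (g \<cdot>\<^bsub>C\<^esub> f)"
      using hyps by (simp add: F.functor_Comp)
    finally show ?thesis
      using hyps by (simp add: algebra_hom_iff)
  qed
  have Ide: "algebra_hom C T a (Ide C (fst a)) a" if "algebra C T a" for a
    using that by (simp add: algebra_iff algebra_hom_iff)
  show ?thesis
    by unfold_locales (auto simp: hom_def Ide intro: Comp, simp_all add: algebra_hom_iff algebra_iff)
qed

text \<open>
  The forgetful functor is faithful, so the functor, naturality and monad laws of a lifted monad are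
  those of \<open>M\<close>. It remains to give algebra structures \<open>\<theta>\<close> for which the images of homomorphisms, the
  units and the multiplications are homomorphisms.
\<close>
lemma lifts_to_algebrasI:
  fixes \<theta> :: "'o \<times> 'm \<Rightarrow> 'm"
  assumes "is_monad C T" "is_monad C M"
    and \<theta>: "\<And>a. algebra C T a \<Longrightarrow> algebra C T (on_obj (Fun M) (fst a), \<theta> a)"
    and arr: "\<And>a b f. algebra C T a \<Longrightarrow> algebra C T b \<Longrightarrow> algebra_hom C T a f b \<Longrightarrow>
      algebra_hom C T (on_obj (Fun M) (fst a), \<theta> a) (on_arr (Fun M) f)
        (on_obj (Fun M) (fst b), \<theta> b)"
    and unit: "\<And>a. algebra C T a \<Longrightarrow>
      algebra_hom C T a (Unit M (fst a)) (on_obj (Fun M) (fst a), \<theta> a)"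
    and mult: "\<And>a. algebra C T a \<Longrightarrow>
      algebra_hom C T
        (on_obj (Fun M) (on_obj (Fun M) (fst a)), \<theta> (on_obj (Fun M) (fst a), \<theta> a))
        (Mult M (fst a)) (on_obj (Fun M) (fst a), \<theta> a)"
  shows "lifts_to_algebras C M T"
proof -
  interpret T: is_monad C T by fact
  interpret M: is_monad C M by fact
  let ?E = "EM_category C T"
  interpret E: category ?E
    by (rule category_EM_category[OF assms(1)])
  define lift where "lift a = (on_obj (Fun M) (fst a), \<theta> a)" for a
  define M' where "M' = \<lparr>
    Fun = \<lparr>on_obj = (\<lambda>a\<in>Obj ?E. lift a),
      on_arr = (\<lambda>(a, f, b)\<in>Arr ?E. (lift a, on_arr (Fun M) f, lift b))\<rparr>,
    Mult = (\<lambda>a\<in>Obj ?E. (lift (lift a), Mult M (fst a), lift a)),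
    Unit = (\<lambda>a\<in>Obj ?E. (a, Unit M (fst a), lift a))\<rparr>"
  have [simp]: "fst (lift a) = on_obj (Fun M) (fst a)" for a
    by (simp add: lift_def)
  have \<theta>': "algebra C T (lift a)" if "algebra C T a" for a
    using \<theta>[OF that] by (simp add: lift_def)
  have arr': "algebra_hom C T (lift a) (on_arr (Fun M) f) (lift b)"
    if "algebra C T a" "algebra C T b" "algebra_hom C T a f b" for a b f
    using arr[OF that] by (simp add: lift_def)
  have unit': "algebra_hom C T a (Unit M (fst a)) (lift a)" if "algebra C T a" for a
    using unit[OF that] by (simp add: lift_def)
  have mult': "algebra_hom C T (lift (lift a)) (Mult M (fst a)) (lift a)" if "algebra C T a" for a
    using mult[OF that] by (simp add: lift_def)
  have [simp]: "on_obj (Fun M') a = lift a" "Unit M' a = (a, Unit M (fst a), lift a)"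
    "Mult M' a = (lift (lift a), Mult M (fst a), lift a)"
    if "algebra C T a" for a
    using that by (simp_all add: M'_def)
  have [simp]: "on_arr (Fun M') (a, f, b) = (lift a, on_arr (Fun M) f, lift b)"
    if "algebra C T a" "algebra C T b" "algebra_hom C T a f b" for a b f
    using that by (simp add: M'_def)
  have hom_simps: "f \<in> Arr C" "Dom C f = fst a" "Cod C f = fst b"
    if "algebra_hom C T a f b" for a f b
    using that by (simp_all add: algebra_hom_iff)
  have fst_Obj: "fst a \<in> Obj C" if "algebra C T a" for a
    using that by (simp add: algebra_iff)
  have Ide_hom: "algebra_hom C T a (Ide C (fst a)) a" if "algebra C T a" for a
    using E.Ide_simps(1)[of a] that by simp
  have Comp_hom: "algebra_hom C T a (g \<cdot>\<^bsub>C\<^esub> f) c"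
    if "algebra_hom C T a f b" "algebra_hom C T b g c"
      "algebra C T a" "algebra C T b" "algebra C T c" for a b c f g
    using E.Comp_simps(1)[of "(a, f, b)" "(b, g, c)"] that by simp
  have EM_arrE: thesis
    if "p \<in> Arr ?E" "\<And>a f b. p = (a, f, b) \<Longrightarrow> algebra C T a \<Longrightarrow> algebra C T b \<Longrightarrow>
      algebra_hom C T a f b \<Longrightarrow> thesis" for p thesis
    using that by auto
  have lift_functor: "is_functor ?E ?E (Fun M')"
  proof (rule is_functorI)
    fix p assume "p \<in> Arr ?E"
    then show "on_arr (Fun M') p \<in> Arr ?E \<and> Dom ?E (on_arr (Fun M') p) = on_obj (Fun M') (Dom ?E p)
        \<and> Cod ?E (on_arr (Fun M') p) = on_obj (Fun M') (Cod ?E p)"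
      by (rule EM_arrE) (simp add: \<theta>' arr')
  next
    fix p q assume "p \<in> Arr ?E" "q \<in> Arr ?E" and pq: "Cod ?E p = Dom ?E q"
    obtain a f b where p: "p = (a, f, b)" "algebra C T a" "algebra C T b" "algebra_hom C T a f b"
      using \<open>p \<in> Arr ?E\<close> by (rule EM_arrE)
    obtain b' g c where q: "q = (b', g, c)" "algebra C T b'" "algebra C T c" "algebra_hom C T b' g c"
      using \<open>q \<in> Arr ?E\<close> by (rule EM_arrE)
    show "on_arr (Fun M') (q \<cdot>\<^bsub>?E\<^esub> p) = on_arr (Fun M') q \<cdot>\<^bsub>?E\<^esub> on_arr (Fun M') p"
      using p q pq Comp_hom[of a f b g c] M.F.functor_Comp[of f g]
      by (simp add: hom_simps)
  next
    fix a assume "a \<in> Obj ?E"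
    then show "on_arr (Fun M') (Ide ?E a) = Ide ?E (on_obj (Fun M') a)"
      by (simp add: Ide_hom fst_Obj)
  qed (simp_all add: E.category_axioms \<theta>', simp_all add: M'_def)
  have "is_monad ?E M'"
  proof (rule is_monadI[OF lift_functor])
    fix p assume "p \<in> Arr ?E"
    then obtain a f b where
      p: "p = (a, f, b)" "algebra C T a" "algebra C T b" "algebra_hom C T a f b"
      by (rule EM_arrE)
    show "on_arr (Fun M') p \<cdot>\<^bsub>?E\<^esub> Mult M' (Dom ?E p) =
        Mult M' (Cod ?E p) \<cdot>\<^bsub>?E\<^esub> on_arr (Fun M') (on_arr (Fun M') p)"
      using p M.Mult_natural[of f] by (simp add: \<theta>' arr' hom_simps[OF p(4)])
    show "on_arr (Fun M') p \<cdot>\<^bsub>?E\<^esub> Unit M' (Dom ?E p) = Unit M' (Cod ?E p) \<cdot>\<^bsub>?E\<^esub> p"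
      using p M.Unit_natural[of f] by (simp add: \<theta>' arr' hom_simps[OF p(4)])
  next
    fix a assume "a \<in> Obj ?E"
    then have a: "algebra C T a"
      by simp
    show "Mult M' a \<cdot>\<^bsub>?E\<^esub> Mult M' (on_obj (Fun M') a) =
        Mult M' a \<cdot>\<^bsub>?E\<^esub> on_arr (Fun M') (Mult M' a)"
      using M.Mult_assoc[OF fst_Obj[OF a]] by (simp add: a \<theta>' mult')
    show "Mult M' a \<cdot>\<^bsub>?E\<^esub> Unit M' (on_obj (Fun M') a) = Ide ?E (on_obj (Fun M') a)"
      using M.Mult_Unit[OF fst_Obj[OF a]] by (simp add: a \<theta>')
    show "Mult M' a \<cdot>\<^bsub>?E\<^esub> on_arr (Fun M') (Unit M' a) = Ide ?E (on_obj (Fun M') a)"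
      using M.Mult_Fun_Unit[OF fst_Obj[OF a]] by (simp add: a \<theta>' unit')
  qed (simp_all add: \<theta>' unit' mult', simp_all add: M'_def)
  moreover have "functor_comp ?E (EM_forgetful C T) (Fun M') =
      functor_comp ?E (Fun M) (EM_forgetful C T)"
  proof -
    have "on_obj (EM_forgetful C T) (on_obj (Fun M') a) = on_obj (Fun M) (on_obj (EM_forgetful C T) a)"
      if "a \<in> Obj ?E" for a
      using that by (simp add: \<theta>')
    moreover have "on_arr (EM_forgetful C T) (on_arr (Fun M') p) =
        on_arr (Fun M) (on_arr (EM_forgetful C T) p)"
      if "p \<in> Arr ?E" for p
      using that by (rule EM_arrE) (simp add: \<theta>' arr')
    ultimately show ?thesis
      unfolding functor_comp_def compose_def by (simp cong: restrict_cong)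
  qed
  moreover have "on_arr (EM_forgetful C T) (Unit M' a) = Unit M (on_obj (EM_forgetful C T) a)"
    "on_arr (EM_forgetful C T) (Mult M' a) = Mult M (on_obj (EM_forgetful C T) a)"
    if "a \<in> Obj ?E" for a
    using that by (simp_all add: \<theta>' unit' mult')
  ultimately show ?thesis
    unfolding lifts_to_algebras_def by blast
qed


section \<open>Epireflections\<close>

locale epireflection = category C
  for C :: "('o, 'm) category" (structure) +
  fixes A :: "'o set" and R :: "('o, 'm, 'o, 'm) cat_functor" and r :: "'o \<Rightarrow> 'm"
  assumes epireflector: "epireflector C A R r"
begin

text \<open>
  The adjunction between \<open>C\<close> and the full subcategory, rewritten with all functors into \<open>C\<close> itself. The
  retraction of \<open>r Y\<close> is the counit at \<open>Y\<close>.
\<close>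
lemma reflector_data:
  shows is_functor_R: "is_functor C C R"
    and R_in_A [simp]: "X \<in> Obj C \<Longrightarrow> on_obj R X \<in> A"
    and nat_trans_r: "nat_trans C C (identity_functor C) R r"
    and ex_retraction: "Y \<in> A \<Longrightarrow>
      \<exists>e. e \<in> Arr C \<and> Dom C e = on_obj R Y \<and> Cod C e = Y \<and> e \<cdot> r Y = Ide C Y"
proof -
  obtain \<epsilon> where "adjunction C (full_subcategory C A) R (inclusion_functor (full_subcategory C A)) r \<epsilon>"
    and A: "A \<subseteq> Obj C"
    using epireflector unfolding epireflector_def reflector_def by blast
  then interpret adj: adjunction C "full_subcategory C A" R
    "inclusion_functor (full_subcategory C A)" r \<epsilon> by simp
  have R: "on_obj R X \<in> Obj C" "on_obj R X \<in> A" if "X \<in> Obj C" for X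
    using adj.L.functor_simps(1)[OF that] by auto
  have R_arr: "on_arr R f \<in> Arr C" "Dom C (on_arr R f) = on_obj R (Dom C f)"
    "Cod C (on_arr R f) = on_obj R (Cod C f)" if "f \<in> Arr C" for f
    using adj.L.functor_simps(2-4)[OF that] by auto
  show functor_R: "is_functor C C R"
    by (rule is_functorI)
      (use adj.L.on_obj_PiE adj.L.on_arr_extensional adj.L.functor_Comp
        in \<open>auto simp: category_axioms R R_arr PiE_def\<close>)
  show "on_obj R X \<in> A" if "X \<in> Obj C"
    using R(2)[OF that] .
  show "nat_trans C C (identity_functor C) R r"
    by (rule nat_transI)
      (use functor_R adj.unit.naturality_Arr adj.unit.component_extensional
        in \<open>auto simp: is_functor_identity category_axioms R R_arr\<close>)
  show "\<exists>e. e \<in> Arr C \<and> Dom C e = on_obj R Y \<and> Cod C e = Y \<and> e \<cdot> r Y = Ide C Y" if "Y \<in> A"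
    using that A adj.triangle_G[of Y] adj.counit.component_simps[of Y] by (intro exI[of _ "\<epsilon> Y"]) auto
qed

sublocale R: is_functor C C R
  by (rule is_functor_R)

sublocale r: nat_trans C C "identity_functor C" R r
  by (rule nat_trans_r)

lemma A_Obj [simp]: "Y \<in> A \<Longrightarrow> Y \<in> Obj C"
  using epireflector unfolding epireflector_def reflector_def by blast

lemma r_simps [simp]:
  assumes "X \<in> Obj C"
  shows "r X \<in> Arr C" "Dom C (r X) = X" "Cod C (r X) = on_obj R X" "epi C (r X)"
  using r.component_simps[OF assms] epireflector assms
  unfolding epireflector_def by auto

lemma r_natural:
  assumes "f \<in> Arr C"
  shows "on_arr R f \<cdot> r (Dom C f) = r (Cod C f) \<cdot> f"
  using r.naturality_Arr[OF assms] assms by simp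

text \<open>
  The composite \<open>R f \<cdot> r = r \<cdot> f\<close> is epi, hence so is its second factor \<open>R f\<close>. This uses that
  the components of \<open>r\<close> are epi in \<open>C\<close>: a left adjoint alone would only make \<open>R f\<close> epi in the
  subcategory.
\<close>
lemma R_preserves_epi:
  assumes "epi C f"
  shows "epi C (on_arr R f)"
proof (rule epi_of_Comp)
  have "f \<in> Arr C"
    using assms by (simp add: epi_def)
  then show "epi C (on_arr R f \<cdot> r (Dom C f))" "r (Dom C f) \<in> Arr C" "on_arr R f \<in> Arr C"
    "Cod C (r (Dom C f)) = Dom C (on_arr R f)"
    using epi_Comp[OF assms, of "r (Cod C f)"] by (simp_all add: r_natural)
qed

lemma ex_factor_through_r:
  assumes "f \<in> Arr C" "Cod C f \<in> A"
  shows "\<exists>g. g \<in> Arr C \<and> Dom C g = on_obj R (Dom C f) \<and> Cod C g = Cod C f \<and> g \<cdot> r (Dom C f) = f"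
proof -
  obtain e where e: "e \<in> Arr C" "Dom C e = on_obj R (Cod C f)" "Cod C e = Cod C f"
      "e \<cdot> r (Cod C f) = Ide C (Cod C f)"
    using ex_retraction[OF assms(2)] by blast
  have "(e \<cdot> on_arr R f) \<cdot> r (Dom C f) = f"
    using e assms(1) extend_eq[OF e(4), of f] by (simp add: r_natural)
  then show ?thesis
    using e assms(1) by (intro exI[of _ "e \<cdot> on_arr R f"]) simp
qed

definition factor_through_r :: "'m \<Rightarrow> 'm" where
  "factor_through_r f = (SOME g. g \<in> Arr C \<and> Dom C g = on_obj R (Dom C f) \<and>
    Cod C g = Cod C f \<and> g \<cdot> r (Dom C f) = f)"

lemma factor_through_r [simp]:
  assumes "f \<in> Arr C" "Cod C f \<in> A"
  shows "factor_through_r f \<in> Arr C" "Dom C (factor_through_r f) = on_obj R (Dom C f)"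
    "Cod C (factor_through_r f) = Cod C f"
    "Dom C f = X \<Longrightarrow> factor_through_r f \<cdot> r X = f"
  using someI_ex[OF ex_factor_through_r[OF assms]] by (auto simp: factor_through_r_def)

text \<open>
  As \<open>A\<close> may fail to be closed under isomorphism, the objects isomorphic to one of \<open>A\<close> are described by
  invertibility of \<open>r\<close>.
\<close>
definition reflective :: "'o \<Rightarrow> bool" where
  "reflective X \<longleftrightarrow> X \<in> Obj C \<and> (\<exists>g. inverse_arrows C (r X) g)"

text \<open>
  Retracts of objects of \<open>A\<close> are reflective: \<open>i\<close> extends along \<open>r X\<close>, and \<open>p\<close> composed with the
  extension is a left inverse of \<open>r X\<close>. A split mono that is epi is invertible.
\<close>
lemma reflectiveI:
  assumes "Y \<in> A" "i \<in> Arr C" "p \<in> Arr C" "Dom C i = X" "Cod C i = Y" "Dom C p = Y" "Cod C p = X"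
    and "p \<cdot> i = Ide C X"
  shows "reflective X"
proof -
  have X: "X \<in> Obj C"
    using Dom_Obj[of i] assms by simp
  let ?g = "p \<cdot> factor_through_r i"
  have gr: "?g \<cdot> r X = Ide C X"
    using assms X by simp
  have "r X \<cdot> ?g = Ide C (on_obj R X)"
  proof (rule epi_cancel)
    show "epi C (r X)"
      using X by simp
    have "(r X \<cdot> ?g) \<cdot> r X = r X \<cdot> (?g \<cdot> r X)"
      by (rule assoc) (use X assms in simp_all)
    then show "(r X \<cdot> ?g) \<cdot> r X = Ide C (on_obj R X) \<cdot> r X"
      using X gr by simp
  qed (use X assms in simp_all)
  then have "inverse_arrows C (r X) ?g"
    using gr X assms by (simp add: inverse_arrows_def hom_def)
  then show ?thesis
    using X unfolding reflective_def by blast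
qed

lemma A_reflective [simp]: "Y \<in> A \<Longrightarrow> reflective Y"
  by (rule reflectiveI[of Y "Ide C Y" "Ide C Y"]) simp_all

lemma inv_r [simp]:
  assumes "reflective X"
  shows "X \<in> Obj C" "inv_arr C (r X) \<in> Arr C" "Dom C (inv_arr C (r X)) = on_obj R X"
    "Cod C (inv_arr C (r X)) = X" "inv_arr C (r X) \<cdot> r X = Ide C X"
    "r X \<cdot> inv_arr C (r X) = Ide C (on_obj R X)"
proof -
  obtain g where g: "inverse_arrows C (r X) g" and X: "X \<in> Obj C"
    using assms unfolding reflective_def by blast
  show "X \<in> Obj C" "inv_arr C (r X) \<in> Arr C" "Dom C (inv_arr C (r X)) = on_obj R X"
    "Cod C (inv_arr C (r X)) = X" "inv_arr C (r X) \<cdot> r X = Ide C X"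
    "r X \<cdot> inv_arr C (r X) = Ide C (on_obj R X)"
    using g X by (simp_all add: inv_arr_eq[OF g]) (simp_all add: inverse_arrows_def hom_def)
qed

lemma inv_r_natural:
  assumes "f \<in> Arr C" "reflective (Dom C f)" "reflective (Cod C f)"
  shows "f \<cdot> inv_arr C (r (Dom C f)) = inv_arr C (r (Cod C f)) \<cdot> on_arr R f"
proof (rule epi_cancel)
  show "epi C (r (Dom C f))"
    using assms by simp
  show "(f \<cdot> inv_arr C (r (Dom C f))) \<cdot> r (Dom C f) =
      (inv_arr C (r (Cod C f)) \<cdot> on_arr R f) \<cdot> r (Dom C f)"
    using assms r_natural[of f] extend_eq[OF inv_r(5)[of "Cod C f"], of f] by simp
qed (use assms in simp_all)

lemma R_r: "X \<in> Obj C \<Longrightarrow> on_arr R (r X) = r (on_obj R X)"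
  by (rule epi_cancel[of "r X"]) (use r_natural[of "r X"] in simp_all)

abbreviation reflection :: "('o, 'm) monad" where
  "reflection \<equiv> reflector_monad C R r"

lemma reflection_simps [simp]:
  "Fun reflection = R" "Unit reflection = r"
  "X \<in> Obj C \<Longrightarrow> Mult reflection X = inv_arr C (r (on_obj R X))"
  by (simp_all add: reflector_monad_def)

lemma is_monad_reflection: "is_monad C reflection"
proof (rule is_monadI)
  show "Mult reflection \<in> extensional (Obj C)"
    by (simp add: reflector_monad_def)
next
  fix X assume X: "X \<in> Obj C"
  have inv: "inv_arr C (r (on_obj R X)) \<cdot> r (on_obj R X) = Ide C (on_obj R X)"
    using X by simp
  have "on_arr R (inv_arr C (r (on_obj R X))) = inv_arr C (r (on_obj R (on_obj R X)))"
  proof (rule epi_cancel)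
    show "epi C (on_arr R (r (on_obj R X)))"
      using X by (simp add: R_preserves_epi)
    show "on_arr R (inv_arr C (r (on_obj R X))) \<cdot> on_arr R (r (on_obj R X)) =
        inv_arr C (r (on_obj R (on_obj R X))) \<cdot> on_arr R (r (on_obj R X))"
      using X by (simp add: R.functor_Comp[symmetric]) (simp add: R_r)
  qed (use X in simp_all)
  then show "Mult reflection X \<cdot> Mult reflection (on_obj (Fun reflection) X) =
      Mult reflection X \<cdot> on_arr (Fun reflection) (Mult reflection X)"
    using X by simp
next
  fix f assume "f \<in> Arr C"
  then show "on_arr (Fun reflection) f \<cdot> Mult reflection (Dom C f) =
      Mult reflection (Cod C f) \<cdot> on_arr (Fun reflection) (on_arr (Fun reflection) f)"
    using inv_r_natural[of "on_arr R f"] by simp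
qed (use r_natural in \<open>simp_all add: r.component_extensional R.is_functor_axioms R_r\<close>)

text \<open>
  An algebra \<open>(X, \<xi>)\<close> exhibits \<open>X\<close> as a retract of \<open>S X\<close>, so \<open>r X\<close> is invertible. The lifted structure
  \<open>\<theta>\<close> is \<open>\<xi>\<close> transported along \<open>r X\<close>, so that \<open>r X\<close> becomes an isomorphism of algebras; the multiplication of the
  reflector is an inverse of some \<open>r\<close> and thus a homomorphism too.
\<close>
lemma lifts_to_algebras_of_range:
  assumes "is_monad C S" and range: "\<And>X. X \<in> Obj C \<Longrightarrow> on_obj (Fun S) X \<in> A"
  shows "lifts_to_algebras C reflection S"
proof -
  interpret S: is_monad C S by fact
  let ?S = "on_arr (Fun S)"
  define \<theta> where "\<theta> a = r (fst a) \<cdot> (snd a \<cdot> ?S (inv_arr C (r (fst a))))" for a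
  have alg: "fst a \<in> Obj C" "snd a \<in> Arr C" "Dom C (snd a) = on_obj (Fun S) (fst a)"
    "Cod C (snd a) = fst a" "snd a \<cdot> Unit S (fst a) = Ide C (fst a)"
    "snd a \<cdot> Mult S (fst a) = snd a \<cdot> ?S (snd a)"
    if "algebra C S a" for a
    using that by (simp_all add: algebra_iff)
  have refl [simp]: "reflective (fst a)" if "algebra C S a" for a
    by (rule reflectiveI[OF range[of "fst a"], of "Unit S (fst a)" "snd a"])
      (use alg[OF that] in simp_all)
  have \<theta>_simps: "\<theta> a \<in> Arr C" "Dom C (\<theta> a) = on_obj (Fun S) (on_obj R (fst a))"
    "Cod C (\<theta> a) = on_obj R (fst a)"
    if "algebra C S a" for a
    using alg[OF that] refl[OF that] by (simp_all add: \<theta>_def)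
  have \<theta>_r: "\<theta> a \<cdot> ?S (r (fst a)) = r (fst a) \<cdot> snd a" if "algebra C S a" for a
    using alg[OF that] refl[OF that] by (simp add: \<theta>_def S.F.functor_Comp[symmetric])
  have inv_\<theta>: "inv_arr C (r (fst a)) \<cdot> \<theta> a = snd a \<cdot> ?S (inv_arr C (r (fst a)))"
    if "algebra C S a" for a
    using alg[OF that] refl[OF that]
      extend_eq[OF inv_r(5)[OF refl[OF that]], of "snd a \<cdot> ?S (inv_arr C (r (fst a)))"]
    by (simp add: \<theta>_def)
  have lift: "algebra C S (on_obj R (fst a), \<theta> a)" if a: "algebra C S a" for a
  proof -
    note [simp] = alg[OF a] refl[OF a]
    let ?i = "inv_arr C (r (fst a))"
    have "\<theta> a \<cdot> Unit S (on_obj R (fst a)) = r (fst a) \<cdot> (snd a \<cdot> (Unit S (fst a) \<cdot> ?i))"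
      using S.Unit_natural[of ?i] by (simp add: \<theta>_def)
    then have unit: "\<theta> a \<cdot> Unit S (on_obj R (fst a)) = Ide C (on_obj R (fst a))"
      using extend_eq[OF alg(5)[OF a], of ?i] by simp
    have "\<theta> a \<cdot> Mult S (on_obj R (fst a)) = r (fst a) \<cdot> (snd a \<cdot> (Mult S (fst a) \<cdot> ?S (?S ?i)))"
      using S.Mult_natural[of ?i] by (simp add: \<theta>_def)
    also have "\<dots> = r (fst a) \<cdot> (snd a \<cdot> ?S (snd a \<cdot> ?S ?i))"
      using extend_eq[OF alg(6)[OF a], of "?S (?S ?i)"] by (simp add: S.F.functor_Comp)
    also have "\<dots> = r (fst a) \<cdot> (snd a \<cdot> ?S (?i \<cdot> \<theta> a))"
      by (simp add: inv_\<theta>[OF a])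
    also have "\<dots> = \<theta> a \<cdot> ?S (\<theta> a)"
      using \<theta>_simps[OF a] by (simp add: S.F.functor_Comp \<theta>_def[of a])
    finally show ?thesis
      using unit \<theta>_simps[OF a] by (simp add: algebra_iff)
  qed
  have unit: "algebra_hom C S a (r (fst a)) (on_obj R (fst a), \<theta> a)" if "algebra C S a" for a
    using alg[OF that] \<theta>_r[OF that] by (simp add: algebra_hom_iff)
  show ?thesis
  proof (rule lifts_to_algebrasI[where \<theta> = \<theta>, OF assms(1) is_monad_reflection])
    fix a b f assume a: "algebra C S a" and b: "algebra C S b" and f: "algebra_hom C S a f b"
    have f': "f \<in> Arr C" "Dom C f = fst a" "Cod C f = fst b" "f \<cdot> snd a = snd b \<cdot> ?S f"
      using f by (simp_all add: algebra_hom_iff)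
    note [simp] = alg[OF a] refl[OF a] alg[OF b] refl[OF b] f'(1-3)
    let ?i = "inv_arr C (r (fst a))" and ?j = "inv_arr C (r (fst b))"
    have nat: "on_arr R f \<cdot> r (fst a) = r (fst b) \<cdot> f" "f \<cdot> ?i = ?j \<cdot> on_arr R f"
      using r_natural[of f] inv_r_natural[of f] by simp_all
    have "on_arr R f \<cdot> \<theta> a = r (fst b) \<cdot> (f \<cdot> (snd a \<cdot> ?S ?i))"
      using extend_eq[OF nat(1), of "snd a \<cdot> ?S ?i"] by (simp add: \<theta>_def)
    also have "\<dots> = r (fst b) \<cdot> (snd b \<cdot> ?S (f \<cdot> ?i))"
      using extend_eq[OF f'(4), of "?S ?i"] by (simp add: S.F.functor_Comp)
    also have "\<dots> = \<theta> b \<cdot> ?S (on_arr R f)"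
      by (simp add: nat(2)) (simp add: S.F.functor_Comp \<theta>_def)
    finally show "algebra_hom C S (on_obj (Fun reflection) (fst a), \<theta> a) (on_arr (Fun reflection) f)
        (on_obj (Fun reflection) (fst b), \<theta> b)"
      by (simp add: algebra_hom_iff)
  next
    fix a assume a: "algebra C S a"
    show "algebra_hom C S
        (on_obj (Fun reflection) (on_obj (Fun reflection) (fst a)),
          \<theta> (on_obj (Fun reflection) (fst a), \<theta> a))
        (Mult reflection (fst a)) (on_obj (Fun reflection) (fst a), \<theta> a)"
      using alg[OF a] inv_\<theta>[OF lift[OF a]] by (simp add: algebra_hom_iff)
  qed (use lift unit in simp_all)
qed

end


section \<open>The composite monad\<close>

locale liftable_monad = epireflection C A R r + T: is_monad C T
  for C :: "('o, 'm) category" (structure) and A :: "'o set"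
    and R :: "('o, 'm, 'o, 'm) cat_functor" and r :: "'o \<Rightarrow> 'm"
    and T :: "('o, 'm) monad" +
  assumes preserves_epis: "preserves_epis C (Fun T)"
    and lifts: "lifts_to_algebras C reflection T"
begin

abbreviation "To \<equiv> on_obj (Fun T)"
abbreviation "Ta \<equiv> on_arr (Fun T)"

lemma T_epi [simp]: "epi C f \<Longrightarrow> epi C (Ta f)"
  using preserves_epis by (simp add: preserves_epis_def)

text \<open>
  The lifted monad provides the structure \<open>\<theta>\<close>; its unit at \<open>a\<close> is a homomorphism with underlying
  arrow \<open>r\<close>.
\<close>
lemma ex_reflected_algebra:
  assumes a: "algebra C T a"
  shows "\<exists>\<theta>. algebra C T (on_obj R (fst a), \<theta>) \<and>
    algebra_hom C T a (r (fst a)) (on_obj R (fst a), \<theta>)"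
proof -
  let ?E = "EM_category C T" and ?G = "EM_forgetful C T"
  have aE: "a \<in> Obj ?E"
    using a by simp
  obtain M' where M': "is_monad ?E M'"
    and eq: "functor_comp ?E ?G (Fun M') = functor_comp ?E R ?G"
    and unit: "on_arr ?G (Unit M' a) = r (on_obj ?G a)"
    using lifts aE unfolding lifts_to_algebras_def reflection_simps by blast
  interpret M': is_monad ?E M' by fact
  obtain b where b: "b = on_obj (Fun M') a" "algebra C T b"
    using M'.F.functor_simps(1)[of a] a by simp
  have "on_obj (functor_comp ?E ?G (Fun M')) a = on_obj (functor_comp ?E R ?G) a"
    using eq by simp
  then have "fst b = on_obj R (fst a)"
    using a b by simp
  moreover obtain f where f: "Unit M' a = (a, f, b)" "algebra_hom C T a f b"
    using M'.monad_simps(4-6)[of a] a b by (cases "Unit M' a") simp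
  moreover have "f = r (fst a)"
    using unit a b(2) f by simp
  ultimately show ?thesis
    using b by (intro exI[of _ "snd b"]) (metis prod.collapse)
qed

text \<open>
  The \<open>T\<close>-algebra structure on \<open>R (T X)\<close> induced by the free algebra \<open>T X\<close>. As \<open>T (r (T X))\<close> is epi,
  the condition on \<open>\<theta>\<close> determines it, so that the choice is harmless and \<open>act\<close> is natural.
\<close>
definition act :: "'o \<Rightarrow> 'm" where
  "act X = (SOME \<theta>. algebra C T (on_obj R (To X), \<theta>) \<and>
    algebra_hom C T (To X, Mult T X) (r (To X)) (on_obj R (To X), \<theta>))"

lemma act:
  assumes "X \<in> Obj C"
  shows act_algebra: "algebra C T (on_obj R (To X), act X)"
    and act_r: "act X \<cdot> Ta (r (To X)) = r (To X) \<cdot> Mult T X"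
proof -
  have "algebra C T (To X, Mult T X)"
    using assms T.Mult_assoc T.Mult_Unit by (simp add: algebra_iff)
  from someI_ex[OF ex_reflected_algebra[OF this]]
  have "algebra C T (on_obj R (To X), act X) \<and>
      algebra_hom C T (To X, Mult T X) (r (To X)) (on_obj R (To X), act X)"
    by (simp add: act_def)
  then show "algebra C T (on_obj R (To X), act X)" "act X \<cdot> Ta (r (To X)) = r (To X) \<cdot> Mult T X"
    by (simp_all add: algebra_hom_iff)
qed

lemma act_simps [simp]:
  assumes "X \<in> Obj C"
  shows "act X \<in> Arr C" "Dom C (act X) = To (on_obj R (To X))" "Cod C (act X) = on_obj R (To X)"
  using act_algebra[OF assms] by (simp_all add: algebra_iff)

lemma act_natural:
  assumes f: "f \<in> Arr C"
  shows "on_arr R (Ta f) \<cdot> act (Dom C f) = act (Cod C f) \<cdot> Ta (on_arr R (Ta f))"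
proof (rule epi_cancel)
  let ?X = "Dom C f" and ?Y = "Cod C f"
  have nat: "on_arr R (Ta f) \<cdot> r (To ?X) = r (To ?Y) \<cdot> Ta f"
    using r_natural[of "Ta f"] f by simp
  show "epi C (Ta (r (To ?X)))"
    using f by simp
  have "(on_arr R (Ta f) \<cdot> act ?X) \<cdot> Ta (r (To ?X)) = r (To ?Y) \<cdot> (Ta f \<cdot> Mult T ?X)"
    using f extend_eq[OF nat, of "Mult T ?X"] by (simp add: act_r)
  also have "\<dots> = (r (To ?Y) \<cdot> Mult T ?Y) \<cdot> Ta (Ta f)"
    using f T.Mult_natural[OF f] by simp
  also have "\<dots> = act ?Y \<cdot> Ta (r (To ?Y) \<cdot> Ta f)"
    using f act_r[of ?Y, symmetric] by (simp add: T.F.functor_Comp)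
  also have "\<dots> = (act ?Y \<cdot> Ta (on_arr R (Ta f))) \<cdot> Ta (r (To ?X))"
    using f by (simp add: T.F.functor_Comp flip: nat)
  finally show "(on_arr R (Ta f) \<cdot> act ?X) \<cdot> Ta (r (To ?X)) =
      (act ?Y \<cdot> Ta (on_arr R (Ta f))) \<cdot> Ta (r (To ?X))" .
qed (use f in simp_all)

definition RT :: "('o, 'm) monad" where
  "RT = \<lparr>Fun = functor_comp C R (Fun T), Mult = (\<lambda>X\<in>Obj C. factor_through_r (act X)),
    Unit = (\<lambda>X\<in>Obj C. r (To X) \<cdot> Unit T X)\<rparr>"

lemma RT_simps [simp]:
  shows "X \<in> Obj C \<Longrightarrow> on_obj (Fun RT) X = on_obj R (To X)"
    and "f \<in> Arr C \<Longrightarrow> on_arr (Fun RT) f = on_arr R (Ta f)"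
    and "X \<in> Obj C \<Longrightarrow> Mult RT X = factor_through_r (act X)"
    and "X \<in> Obj C \<Longrightarrow> Unit RT X = r (To X) \<cdot> Unit T X"
  by (simp_all add: RT_def)

lemma is_functor_RT: "is_functor C C (Fun RT)"
  unfolding RT_def by (simp add: is_functor_comp[OF T.F.is_functor_axioms is_functor_R])

text \<open>
  The first unit law is the unit law of the algebra \<open>act X\<close>. Cancelling \<open>r\<close> reduces the second one
  to that of \<open>T\<close>; cancelling \<open>r\<close> and then \<open>T r\<close> reduces associativity to the associativity of
  \<open>act X\<close>.
\<close>
lemma is_monad_RT: "is_monad C RT"
proof (rule is_monadI[OF is_functor_RT])
  fix f assume f: "f \<in> Arr C"
  let ?X = "Dom C f" and ?Y = "Cod C f"
  have nat: "on_arr R (Ta f) \<cdot> r (To ?X) = r (To ?Y) \<cdot> Ta f"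
    using r_natural[of "Ta f"] f by simp
  then show "on_arr (Fun RT) f \<cdot> Unit RT ?X = Unit RT ?Y \<cdot> f"
    using f extend_eq[OF nat, of "Unit T ?X"] T.Unit_natural[OF f] by simp
  let ?w = "\<lambda>X. factor_through_r (act X)"
  have "on_arr R (Ta f) \<cdot> ?w ?X = ?w ?Y \<cdot> on_arr R (Ta (on_arr R (Ta f)))"
  proof (rule epi_cancel)
    show "epi C (r (To (on_obj R (To ?X))))"
      using f by simp
    have "?w ?Y \<cdot> (on_arr R (Ta (on_arr R (Ta f))) \<cdot> r (To (on_obj R (To ?X)))) =
        act ?Y \<cdot> Ta (on_arr R (Ta f))"
      using f r_natural[of "Ta (on_arr R (Ta f))"]
        extend_eq[of "?w ?Y" "r (To (on_obj R (To ?Y)))" "act ?Y" "Ta (on_arr R (Ta f))"]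
      by simp
    then show "(on_arr R (Ta f) \<cdot> ?w ?X) \<cdot> r (To (on_obj R (To ?X))) =
        (?w ?Y \<cdot> on_arr R (Ta (on_arr R (Ta f)))) \<cdot> r (To (on_obj R (To ?X)))"
      using f act_natural[OF f] by simp
  qed (use f in simp_all)
  then show "on_arr (Fun RT) f \<cdot> Mult RT ?X =
      Mult RT ?Y \<cdot> on_arr (Fun RT) (on_arr (Fun RT) f)"
    using f by simp
next
  fix X assume X: "X \<in> Obj C"
  let ?Y = "on_obj R (To X)" and ?w = "factor_through_r (act X)"
  note alg = act_algebra[OF X, unfolded algebra_iff fst_conv snd_conv]
  have w_r: "?w \<cdot> r (To ?Y) = act X"
    using X by simp
  show "Mult RT X \<cdot> Unit RT (on_obj (Fun RT) X) = Ide C (on_obj (Fun RT) X)"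
    using X alg extend_eq[OF w_r, of "Unit T ?Y"] by simp
  have "?w \<cdot> on_arr R (Ta (r (To X) \<cdot> Unit T X)) = Ide C ?Y"
  proof (rule epi_cancel)
    show "epi C (r (To X))"
      using X by simp
    have "(?w \<cdot> on_arr R (Ta (r (To X) \<cdot> Unit T X))) \<cdot> r (To X) =
        (?w \<cdot> r (To ?Y)) \<cdot> Ta (r (To X) \<cdot> Unit T X)"
      using X r_natural[of "Ta (r (To X) \<cdot> Unit T X)"] by (simp del: factor_through_r(4))
    also have "\<dots> = (act X \<cdot> Ta (r (To X))) \<cdot> Ta (Unit T X)"
      using X by (simp add: T.F.functor_Comp)
    also have "\<dots> = r (To X)"
      using X T.Mult_Fun_Unit[OF X] by (simp add: act_r[OF X])
    finally show "(?w \<cdot> on_arr R (Ta (r (To X) \<cdot> Unit T X))) \<cdot> r (To X) = Ide C ?Y \<cdot> r (To X)"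
      using X by simp
  qed (use X in simp_all)
  then show "Mult RT X \<cdot> on_arr (Fun RT) (Unit RT X) = Ide C (on_obj (Fun RT) X)"
    using X by simp
  let ?w' = "factor_through_r (act ?Y)"
  let ?Z = "on_obj R (To ?Y)"
  have w'_r: "?w' \<cdot> r (To ?Z) = act ?Y"
    using X by simp
  \<comment> \<open>associativity after cancelling \<open>r\<close>: \<open>?w\<close> is a homomorphism of \<open>T\<close>-algebras\<close>
  have inner: "?w \<cdot> act ?Y = act X \<cdot> Ta ?w"
  proof (rule epi_cancel)
    show "epi C (Ta (r (To ?Y)))"
      using X by simp
    have "(?w \<cdot> act ?Y) \<cdot> Ta (r (To ?Y)) = (?w \<cdot> r (To ?Y)) \<cdot> Mult T ?Y"
      using X by (simp add: act_r del: factor_through_r(4))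
    also have "\<dots> = act X \<cdot> Ta (?w \<cdot> r (To ?Y))"
      using alg by (simp add: w_r)
    also have "\<dots> = (act X \<cdot> Ta ?w) \<cdot> Ta (r (To ?Y))"
      using X by (simp add: T.F.functor_Comp del: factor_through_r(4))
    finally show "(?w \<cdot> act ?Y) \<cdot> Ta (r (To ?Y)) = (act X \<cdot> Ta ?w) \<cdot> Ta (r (To ?Y))" .
  qed (use X in simp_all)
  have "?w \<cdot> ?w' = ?w \<cdot> on_arr R (Ta ?w)"
  proof (rule epi_cancel)
    show "epi C (r (To ?Z))"
      using X by simp
    have "(?w \<cdot> on_arr R (Ta ?w)) \<cdot> r (To ?Z) = (?w \<cdot> r (To ?Y)) \<cdot> Ta ?w"
      using X r_natural[of "Ta ?w"] by (simp del: factor_through_r(4))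
    then show "(?w \<cdot> ?w') \<cdot> r (To ?Z) = (?w \<cdot> on_arr R (Ta ?w)) \<cdot> r (To ?Z)"
      using X inner by (simp add: w_r)
  qed (use X in simp_all)
  then show "Mult RT X \<cdot> Mult RT (on_obj (Fun RT) X) = Mult RT X \<cdot> on_arr (Fun RT) (Mult RT X)"
    using X by simp
qed (simp_all, simp_all add: RT_def)

lemma RT_preserves_epis: "preserves_epis C (Fun RT)"
  unfolding preserves_epis_def
proof (intro allI impI)
  fix f assume "epi C f"
  moreover from this have "f \<in> Arr C"
    by (simp add: epi_def)
  ultimately show "epi C (on_arr (Fun RT) f)"
    by (simp add: R_preserves_epi)
qed

lemma RT_lifts: "lifts_to_algebras C reflection RT"
  by (rule lifts_to_algebras_of_range[OF is_monad_RT]) simp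

definition rT :: "'o \<Rightarrow> 'm" where
  "rT = (\<lambda>X\<in>Obj C. r (To X))"

lemma monad_morphism_rT: "monad_morphism C T RT rT"
proof -
  have "nat_trans C C (Fun T) (Fun RT) rT"
  proof (rule nat_transI)
    fix f assume f: "f \<in> Arr C"
    then show "on_arr (Fun RT) f \<cdot> rT (Dom C f) = rT (Cod C f) \<cdot> Ta f"
      using r_natural[of "Ta f"] by (simp add: rT_def)
  qed (simp_all add: T.F.is_functor_axioms is_functor_RT rT_def)
  moreover have "rT X \<cdot> Mult T X = Mult RT X \<cdot> (rT (on_obj (Fun RT) X) \<cdot> Ta (rT X))"
    if X: "X \<in> Obj C" for X
    using X extend_eq[of "factor_through_r (act X)" "r (To (on_obj R (To X)))" "act X" "Ta (r (To X))"]
    by (simp add: rT_def act_r)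
  ultimately show ?thesis
    by (simp add: monad_morphism_def monad_morphism_axioms_def T.is_monad_axioms is_monad_RT rT_def)
qed

text \<open>
  Compatibility with the multiplications is an equation between arrows from \<open>R (T (R (T X)))\<close>. Cancelling
  \<open>r\<close> and then \<open>T (r (T X))\<close> turns it into the corresponding equation for \<open>\<alpha>\<close> on \<open>T (T X)\<close>.
\<close>
lemma ex1_factor_through_rT:
  assumes "monad_morphism C T M \<alpha>" and range: "\<And>X. X \<in> Obj C \<Longrightarrow> on_obj (Fun M) X \<in> A"
  shows "\<exists>!\<beta>. monad_morphism C RT M \<beta> \<and> (\<lambda>X\<in>Obj C. \<beta> X \<cdot> rT X) = \<alpha>"
proof -
  interpret \<alpha>: monad_morphism C T M \<alpha> by fact
  let ?Mo = "on_obj (Fun M)" and ?Ma = "on_arr (Fun M)"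
  define \<beta> where "\<beta> = (\<lambda>X\<in>Obj C. factor_through_r (\<alpha> X))"
  have \<beta> [simp]: "\<beta> X \<in> Arr C" "Dom C (\<beta> X) = on_obj R (To X)" "Cod C (\<beta> X) = ?Mo X"
    and \<beta>_r: "\<beta> X \<cdot> r (To X) = \<alpha> X" if "X \<in> Obj C" for X
    using that range[OF that] by (simp_all add: \<beta>_def)
  have "nat_trans C C (Fun RT) (Fun M) \<beta>"
  proof (rule nat_transI)
    fix f assume f: "f \<in> Arr C"
    let ?X = "Dom C f" and ?Y = "Cod C f"
    have "?Ma f \<cdot> \<beta> ?X = \<beta> ?Y \<cdot> on_arr R (Ta f)"
    proof (rule epi_cancel)
      show "epi C (r (To ?X))"
        using f by simp
      have "(\<beta> ?Y \<cdot> on_arr R (Ta f)) \<cdot> r (To ?X) = (\<beta> ?Y \<cdot> r (To ?Y)) \<cdot> Ta f"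
        using f r_natural[of "Ta f"] by simp
      then show "(?Ma f \<cdot> \<beta> ?X) \<cdot> r (To ?X) = (\<beta> ?Y \<cdot> on_arr R (Ta f)) \<cdot> r (To ?X)"
        using f \<alpha>.naturality_Arr[OF f] by (simp add: \<beta>_r)
    qed (use f in simp_all)
    then show "?Ma f \<cdot> \<beta> ?X = \<beta> ?Y \<cdot> on_arr (Fun RT) f"
      using f by simp
  qed (simp_all add: is_functor_RT \<alpha>.T.F.is_functor_axioms, simp add: \<beta>_def)
  moreover have "\<beta> X \<cdot> Unit RT X = Unit M X" if X: "X \<in> Obj C" for X
    using X extend_eq[OF \<beta>_r[OF X], of "Unit T X"] \<alpha>.preserves_Unit[OF X] by simp
  moreover have "\<beta> X \<cdot> Mult RT X = Mult M X \<cdot> (\<beta> (?Mo X) \<cdot> on_arr (Fun RT) (\<beta> X))"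
    if X: "X \<in> Obj C" for X
  proof -
    let ?Y = "on_obj R (To X)" and ?w = "factor_through_r (act X)"
    have "\<beta> X \<cdot> act X = Mult M X \<cdot> (\<alpha> (?Mo X) \<cdot> Ta (\<beta> X))"
    proof (rule epi_cancel)
      show "epi C (Ta (r (To X)))"
        using X by simp
      have "(\<beta> X \<cdot> act X) \<cdot> Ta (r (To X)) = (\<beta> X \<cdot> r (To X)) \<cdot> Mult T X"
        using X by (simp add: act_r)
      also have "\<dots> = Mult M X \<cdot> (\<alpha> (?Mo X) \<cdot> Ta (\<beta> X \<cdot> r (To X)))"
        using X \<alpha>.preserves_Mult[OF X] by (simp add: \<beta>_r)
      finally show "(\<beta> X \<cdot> act X) \<cdot> Ta (r (To X)) =
          (Mult M X \<cdot> (\<alpha> (?Mo X) \<cdot> Ta (\<beta> X))) \<cdot> Ta (r (To X))"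
        using X by (simp add: T.F.functor_Comp)
    qed (use X in simp_all)
    moreover have "\<beta> (?Mo X) \<cdot> (on_arr R (Ta (\<beta> X)) \<cdot> r (To ?Y)) = \<alpha> (?Mo X) \<cdot> Ta (\<beta> X)"
      using X r_natural[of "Ta (\<beta> X)"] extend_eq[OF \<beta>_r[of "?Mo X"], of "Ta (\<beta> X)"] by simp
    ultimately have "(\<beta> X \<cdot> ?w) \<cdot> r (To ?Y) =
        (Mult M X \<cdot> (\<beta> (?Mo X) \<cdot> on_arr R (Ta (\<beta> X)))) \<cdot> r (To ?Y)"
      using X by simp
    then have "\<beta> X \<cdot> ?w = Mult M X \<cdot> (\<beta> (?Mo X) \<cdot> on_arr R (Ta (\<beta> X)))"
      by (rule epi_cancel[rotated]) (use X in simp_all)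
    then show ?thesis
      using X by simp
  qed
  ultimately have "monad_morphism C RT M \<beta>"
    by (simp add: monad_morphism_def monad_morphism_axioms_def is_monad_RT \<alpha>.T.is_monad_axioms)
  moreover have "(\<lambda>X\<in>Obj C. \<beta> X \<cdot> rT X) = \<alpha>"
    using \<alpha>.component_extensional
    by (intro extensionalityI[of _ "Obj C"]) (simp_all add: rT_def \<beta>_r)
  moreover have "\<gamma> = \<beta>" if \<gamma>: "monad_morphism C RT M \<gamma>" "(\<lambda>X\<in>Obj C. \<gamma> X \<cdot> rT X) = \<alpha>" for \<gamma>
  proof -
    interpret \<gamma>: monad_morphism C RT M \<gamma> by fact
    have "\<gamma> X = \<beta> X" if X: "X \<in> Obj C" for X
    proof (rule epi_cancel[of "r (To X)"])
      show "\<gamma> X \<cdot> r (To X) = \<beta> X \<cdot> r (To X)"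
        using fun_cong[OF \<gamma>(2), of X] X by (simp add: rT_def \<beta>_r)
    qed (use X in simp_all)
    then show ?thesis
      using \<gamma>.component_extensional by (intro extensionalityI[of _ "Obj C"]) (simp_all add: \<beta>_def)
  qed
  ultimately show ?thesis
    by blast
qed

end


section \<open>The left adjoint\<close>

theorem proposition28:
  fixes C :: "('o, 'm) category" and A :: "'o set"
    and R :: "('o, 'm, 'o, 'm) cat_functor" and r :: "'o \<Rightarrow> 'm"
  assumes "category C" and "epireflector C A R r"
  shows "has_left_adjoint (RMonE C A R r) (MonE C R r) (inclusion_functor (RMonE C A R r))"
proof (rule has_left_adjoint_if_universal_arrows)
  have MonE: "category (MonE C R r)"
    unfolding MonE_def by (intro category_full_subcategory category_monad_category assms(1))
  show "is_functor (RMonE C A R r) (MonE C R r) (inclusion_functor (RMonE C A R r))"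
    unfolding RMonE_def by (rule is_functor_full_inclusion[OF MonE])
  fix T assume T: "T \<in> Obj (MonE C R r)"
  interpret epireflection C A R r
    using assms by (simp add: epireflection_def epireflection_axioms_def)
  interpret liftable_monad C A R r T
    using T epireflection_axioms
    by (simp add: MonE_def liftable_monad_def liftable_monad_axioms_def)
  have RT: "RT \<in> Obj (RMonE C A R r)"
    using is_monad_RT RT_preserves_epis RT_lifts by (simp add: RMonE_def MonE_def)
  have inclusion: "on_obj (inclusion_functor (RMonE C A R r)) M = M" if "M \<in> Obj (RMonE C A R r)" for M
    using that by simp
  have "\<exists>!g. g \<in> hom (RMonE C A R r) RT M \<and>
      on_arr (inclusion_functor (RMonE C A R r)) g \<cdot>\<^bsub>MonE C R r\<^esub> (T, rT, RT) = f"
    if M: "M \<in> Obj (RMonE C A R r)" and f: "f \<in> hom (MonE C R r) T M" for M f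
  proof -
    have hom_RMonE: "g \<in> hom (RMonE C A R r) RT M \<longleftrightarrow>
        (\<exists>\<beta>. g = (RT, \<beta>, M) \<and> monad_morphism C RT M \<beta>)" for g
      using RT M by (cases g) (auto simp: hom_def RMonE_def MonE_def)
    obtain \<alpha> where \<alpha>: "f = (T, \<alpha>, M)" "monad_morphism C T M \<alpha>"
      using f by (cases f) (auto simp: hom_def MonE_def)
    have "\<exists>!\<beta>. monad_morphism C RT M \<beta> \<and> (\<lambda>X\<in>Obj C. \<beta> X \<cdot>\<^bsub>C\<^esub> rT X) = \<alpha>"
      using M by (intro ex1_factor_through_rT[OF \<alpha>(2)]) (simp add: RMonE_def)
    moreover have "on_arr (inclusion_functor (RMonE C A R r)) (RT, \<beta>, M)
        \<cdot>\<^bsub>MonE C R r\<^esub> (T, rT, RT) = (T, (\<lambda>X\<in>Obj C. \<beta> X \<cdot>\<^bsub>C\<^esub> rT X), M)"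
      if "monad_morphism C RT M \<beta>" for \<beta>
    proof -
      have "(RT, \<beta>, M) \<in> Arr (RMonE C A R r)"
        using hom_RMonE[of "(RT, \<beta>, M)"] that by (simp add: hom_def)
      then show ?thesis
        by (simp add: MonE_def)
    qed
    ultimately show ?thesis
      unfolding hom_RMonE \<alpha>(1) by (metis (no_types, lifting) prod.inject)
  qed
  moreover have "(T, rT, RT) \<in> hom (MonE C R r) T RT"
    using T RT monad_morphism_rT by (simp add: hom_def RMonE_def MonE_def)
  ultimately show "\<exists>M\<in>Obj (RMonE C A R r). \<exists>u\<in>hom (MonE C R r) T
      (on_obj (inclusion_functor (RMonE C A R r)) M). \<forall>N\<in>Obj (RMonE C A R r).
      \<forall>f\<in>hom (MonE C R r) T (on_obj (inclusion_functor (RMonE C A R r)) N).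
      \<exists>!g. g \<in> hom (RMonE C A R r) M N \<and>
        on_arr (inclusion_functor (RMonE C A R r)) g \<cdot>\<^bsub>MonE C R r\<^esub> u = f"
    using RT inclusion by (intro bexI[of _ RT] bexI[of _ "(T, rT, RT)"]) simp_all
qed

end
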